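(* Let $b>0$, $w<0$ and $$g(t)=\frac{\sin \pi b(t-iw)}{t-iw}.$$ Then the frame set of $g$ is $$\mathcal{F}_g=\{(\alpha,\beta)\,:\,\alpha,\beta>0,\ \alpha\beta\leq 1,\ \beta\leq b\}.$$
   Context: For $g\in L^2(\mathbb{R})$ and $(x,\omega)\in\mathbb{R}^2$ put $\pi_{x,\omega}g(t)=e^{2\pi i\omega t}g(t-x)$. For $\alpha,\beta>0$ the Gabor system is $\mathcal{G}(g;\alpha,\beta)=\{\pi_{\alpha n,\beta m}g\}_{m,n\in\mathbb{Z}}$. It is a (Gabor) frame if there are constants $A,B>0$ with $A\|f\|_2^2\leq\sum_{m,n\in\mathbb{Z}}|(f,\pi_{\alpha n,\beta m}g)|^2\leq B\|f\|_2^2$ for all $f\in L^2(\mathbb{R})$. The frame set of $g$ is $\mathcal{F}_g=\{(\alpha,\beta):\alpha,\beta>0,\ \mathcal{G}(g;\alpha,\beta)\text{ is a frame}\}$. *)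

theory Defs
  imports "HOL-Analysis.Analysis"
begin

definition L2 :: "(real \<Rightarrow> complex) set" where
  "L2 = {f. f \<in> borel_measurable lborel \<and> integrable lborel (\<lambda>t. (cmod (f t))\<^sup>2)}"

definition l2_inner :: "(real \<Rightarrow> complex) \<Rightarrow> (real \<Rightarrow> complex) \<Rightarrow> complex" where
  "l2_inner f h = (LINT t|lborel. f t * cnj (h t))"

definition l2_norm_sq :: "(real \<Rightarrow> complex) \<Rightarrow> real" where
  "l2_norm_sq f = (LINT t|lborel. (cmod (f t))\<^sup>2)"

definition tf_shift :: "real \<Rightarrow> real \<Rightarrow> (real \<Rightarrow> complex) \<Rightarrow> (real \<Rightarrow> complex)" where
  "tf_shift x \<omega> g = (\<lambda>t. exp (complex_of_real (2 * pi * \<omega> * t) * \<i>) * g (t - x))"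

definition gabor_frame :: "(real \<Rightarrow> complex) \<Rightarrow> real \<Rightarrow> real \<Rightarrow> bool" where
  "gabor_frame g \<alpha> \<beta> \<longleftrightarrow>
     (\<exists>A B. A > 0 \<and> B > 0 \<and>
       (\<forall>f\<in>L2.
          (\<lambda>(m::int, n::int). (cmod (l2_inner f (tf_shift (\<alpha> * of_int n) (\<beta> * of_int m) g)))\<^sup>2)
             summable_on UNIV \<and>
          A * l2_norm_sq f \<le>
            (\<Sum>\<^sub>\<infinity>(m::int, n::int)\<in>UNIV. (cmod (l2_inner f (tf_shift (\<alpha> * of_int n) (\<beta> * of_int m) g)))\<^sup>2) \<and>
          (\<Sum>\<^sub>\<infinity>(m::int, n::int)\<in>UNIV. (cmod (l2_inner f (tf_shift (\<alpha> * of_int n) (\<beta> * of_int m) g)))\<^sup>2)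
            \<le> B * l2_norm_sq f))"

definition frame_set :: "(real \<Rightarrow> complex) \<Rightarrow> (real \<times> real) set" where
  "frame_set g = {(\<alpha>, \<beta>). \<alpha> > 0 \<and> \<beta> > 0 \<and> gabor_frame g \<alpha> \<beta>}"

end

theory Submission
  imports Defs
begin

text \<open>
  The window is \<open>g = \<pi> FT \<gamma>\<close> with \<open>\<gamma> \<xi> = exp (2\<pi>w\<xi>)\<close> on \<open>[-b/2, b/2)\<close> and \<open>0\<close> elsewhere. On the Fourier side,
  Parseval's identity with period \<open>p = 1/\<alpha>\<close> turns the sum of the squared coefficients into
  \<open>(\<pi>\<^sup>2/\<alpha>) \<integral> \<Sum>\<^sub>m |y\<^sub>m(x)|\<^sup>2 dx\<close> over a period, where \<open>y\<^sub>m = \<Sum>\<^sub>k \<gamma>(x + kp - \<beta>m) c\<^sub>k\<close> and \<open>c\<^sub>k\<close> is the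
  Fourier transform of \<open>f\<close> at \<open>x + kp\<close>. So everything is about \<open>\<ell>\<^sup>2\<close> bounds for the matrix
  \<open>\<gamma>(x + kp - \<beta>m)\<close>.

  Lower bound: since \<open>w < 0\<close>, the tails \<open>E\<^sub>k = \<Sum>\<^sub>i r\<^sup>i c\<^sub>k\<^sub>+\<^sub>i\<close> with \<open>r = exp (2\<pi>wp) < 1\<close> converge, and \<open>y\<^sub>m\<close> is, up to a
  bounded factor, \<open>E\<^sub>k - r\<^sup>j E\<^sub>k\<^sub>+\<^sub>j\<close>, where \<open>k, ..., k + j - 1\<close> are the indices seen by the window at \<open>\<beta>m\<close>. For each \<open>k\<close>
  let \<open>m\<close> be the last index whose window starts at or before \<open>x + kp\<close>: \<open>\<beta> \<le> b\<close> puts \<open>x + kp\<close> inside this window, so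
  \<open>j \<ge> 1\<close>, while \<open>\<beta> \<le> p\<close> keeps \<open>x + (k - 1)p\<close> outside and makes these \<open>m\<close> distinct. Iterating this recursion bounds \<open>E\<close>, hence \<open>c\<^sub>k = E\<^sub>k - r E\<^sub>k\<^sub>+\<^sub>1\<close>, by \<open>y\<close>.

  If \<open>\<beta> > b\<close>, a function whose Fourier transform lives in a gap between the translated windows is
  orthogonal to the system. If \<open>\<alpha>\<beta> > 1\<close>, then \<open>N\<close> consecutive unknowns \<open>c\<^sub>k\<close> meet fewer than \<open>N\<close> windows for
  large \<open>N\<close>; as \<open>x\<close> enters the equations only through the common factor \<open>exp (2\<pi>wx)\<close>, one nonzero solution
  serves for all \<open>x\<close> in a small interval \<open>[0, \<epsilon>)\<close> and again yields an orthogonal function.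
\<close>

subsection \<open>Bounded functions of bounded support and their Fourier transforms\<close>

text \<open>One number \<open>R\<close> bounds both the values and the support. Such functions lie
  in L1 and L2 and are stable under products and shifts, so Fourier integrals and periodizations of
  them raise no convergence questions.\<close>

definition tame :: "(real \<Rightarrow> complex) \<Rightarrow> bool" where
  "tame f \<longleftrightarrow> f \<in> borel_measurable borel \<and> (\<exists>R. \<forall>t. cmod (f t) \<le> R \<and> (f t \<noteq> 0 \<longrightarrow> \<bar>t\<bar> \<le> R))"

text \<open>The kernel carries a plus sign, so that \<open>FT\<close> sends the exponential window
  straight to g, up to the factor pi. Consequently the expansions below use \<open>cis\<close> of
  negative arguments, and reflected transforms \<open>FT f (- s)\<close> appear later.\<close>

definition FT :: "(real \<Rightarrow> complex) \<Rightarrow> real \<Rightarrow> complex" where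
  "FT f s = (LINT t|lborel. f t * cis (2 * pi * t * s))"

lemma borel_measurable_cis [measurable]: "cis \<in> borel_measurable borel"
  by (intro borel_measurable_continuous_onI continuous_intros)

lemma borel_measurable_cnj [measurable]: "cnj \<in> borel_measurable borel"
  by (intro borel_measurable_continuous_onI continuous_intros)

text \<open>The multiplier has to be bounded only where \<open>f\<close> lives; this admits
  exponentials, which are unbounded on the whole line.\<close>

lemma tame_mult:
  assumes "tame f" "u \<in> borel_measurable borel" "\<And>t. f t \<noteq> 0 \<Longrightarrow> cmod (u t) \<le> K"
  shows "tame (\<lambda>t. f t * u t)"
proof -
  obtain R where R: "\<And>t. cmod (f t) \<le> R" "\<And>t. f t \<noteq> 0 \<Longrightarrow> \<bar>t\<bar> \<le> R"
    using assms by (auto simp: tame_def)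
  have R0: "R \<ge> 0" using R(1)[of 0] norm_ge_zero order_trans by blast
  \<comment> \<open>The values are bounded by \<open>R * K\<close> and the support radius by
    \<open>R\<close>; a single number has to serve for both, hence the maximum.\<close>
  have "cmod (f t * u t) \<le> max R (R * K) \<and> (f t * u t \<noteq> 0 \<longrightarrow> \<bar>t\<bar> \<le> max R (R * K))" for t
  proof (cases "f t = 0")
    case False
    then have "cmod (f t) * cmod (u t) \<le> R * K"
      using R assms(3) R0 by (intro mult_mono) auto
    then show ?thesis using R(2)[OF False] by (auto simp: norm_mult)
  qed (use R0 in auto)
  moreover have "(\<lambda>t. f t * u t) \<in> borel_measurable borel"
    using assms by (auto simp: tame_def)
  ultimately show ?thesis unfolding tame_def by blast
qed

lemma tame_add:
  assumes "tame f" "tame g"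
  shows "tame (\<lambda>t. f t + g t)"
proof -
  obtain R where R: "\<And>t. cmod (f t) \<le> R" "\<And>t. f t \<noteq> 0 \<Longrightarrow> \<bar>t\<bar> \<le> R"
    using assms by (auto simp: tame_def)
  obtain S where S: "\<And>t. cmod (g t) \<le> S" "\<And>t. g t \<noteq> 0 \<Longrightarrow> \<bar>t\<bar> \<le> S"
    using assms by (auto simp: tame_def)
  have "R \<ge> 0" "S \<ge> 0" using R(1)[of 0] S(1)[of 0] norm_ge_zero order_trans by blast+
  then have "cmod (f t + g t) \<le> R + S \<and> (f t + g t \<noteq> 0 \<longrightarrow> \<bar>t\<bar> \<le> R + S)" for t
    using R[of t] S[of t] norm_triangle_ineq[of "f t" "g t"] by fastforce
  moreover have "(\<lambda>t. f t + g t) \<in> borel_measurable borel"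
    using assms by (auto simp: tame_def)
  ultimately show ?thesis unfolding tame_def by blast
qed

lemma tame_cmult: "tame f \<Longrightarrow> tame (\<lambda>t. c * f t)"
  using tame_mult[of f "\<lambda>_. c" "cmod c"] by (simp add: mult.commute)

lemma tame_indicator: "tame (\<lambda>t. indicator {a..<b} t)"
proof -
  have "cmod (indicator {a..<b} t) \<le> max 1 (max \<bar>a\<bar> \<bar>b\<bar>) \<and> (indicator {a..<b} t \<noteq> (0::complex) \<longrightarrow> \<bar>t\<bar> \<le> max 1 (max \<bar>a\<bar> \<bar>b\<bar>))" for t
    by (auto simp: indicator_def)
  then show ?thesis unfolding tame_def
    by (intro conjI exI[of _ "max 1 (max \<bar>a\<bar> \<bar>b\<bar>)"]) auto
qed

lemma tame_indicator_Icc: "tame (\<lambda>t. indicator {a..b} t)"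
proof -
  have "cmod (indicator {a..b} t) \<le> max 1 (max \<bar>a\<bar> \<bar>b\<bar>) \<and> (indicator {a..b} t \<noteq> (0::complex) \<longrightarrow> \<bar>t\<bar> \<le> max 1 (max \<bar>a\<bar> \<bar>b\<bar>))" for t
    by (auto simp: indicator_def)
  then show ?thesis unfolding tame_def
    by (intro conjI exI[of _ "max 1 (max \<bar>a\<bar> \<bar>b\<bar>)"]) auto
qed

lemma tame_shift:
  assumes "tame f" shows "tame (\<lambda>t. f (t + a))"
proof -
  obtain R where R: "\<And>t. cmod (f t) \<le> R" "\<And>t. f t \<noteq> 0 \<Longrightarrow> \<bar>t\<bar> \<le> R"
    using assms by (auto simp: tame_def)
  have [measurable]: "f \<in> borel_measurable borel" using assms by (simp add: tame_def)
  have "cmod (f (t + a)) \<le> R + \<bar>a\<bar> \<and> (f (t + a) \<noteq> 0 \<longrightarrow> \<bar>t\<bar> \<le> R + \<bar>a\<bar>)" for t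
    using R[of "t + a"] by fastforce
  then show ?thesis unfolding tame_def by (intro conjI exI[of _ "R + \<bar>a\<bar>"]) auto
qed

lemma tame_cnj: "tame f \<Longrightarrow> tame (\<lambda>t. cnj (f t))"
  unfolding tame_def by auto

lemma tame_sum: "finite A \<Longrightarrow> (\<And>k. k \<in> A \<Longrightarrow> tame (f k)) \<Longrightarrow> tame (\<lambda>t. \<Sum>k\<in>A. f k t)"
proof (induction A rule: finite_induct)
  case empty
  show ?case by (auto simp: tame_def intro!: exI[of _ 0])
next
  case (insert x F)
  then show ?case by (simp add: tame_add)
qed

lemma tame_integrable:
  assumes "tame f" shows "integrable lborel f"
proof -
  obtain R where R: "\<And>t. cmod (f t) \<le> R" "\<And>t. f t \<noteq> 0 \<Longrightarrow> \<bar>t\<bar> \<le> R"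
    using assms by (auto simp: tame_def)
  have [measurable]: "f \<in> borel_measurable borel" using assms by (simp add: tame_def)
  have R0: "R \<ge> 0" using R(1)[of 0] norm_ge_zero order_trans by blast
  show ?thesis
  proof (rule Bochner_Integration.integrable_bound)
    show "integrable lborel (\<lambda>t. R * indicat_real {-R..R} t)"
      by (intro integrable_mult_right integrable_real_indicator) (auto simp: emeasure_lborel_Icc_eq)
    show "AE x in lborel. norm (f x) \<le> norm (R * indicat_real {- R..R} x)"
      using R R0 by (intro AE_I2) (fastforce simp: indicator_def abs_le_iff)
  qed auto
qed

lemma tame_prod:
  assumes "tame f" "tame g" shows "tame (\<lambda>t. f t * g t)"
proof -
  obtain R where R: "\<And>t. cmod (g t) \<le> R" using assms by (auto simp: tame_def)
  show ?thesis using assms R by (intro tame_mult[where K = R]) (auto simp: tame_def)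
qed

lemma tame_square_integrable:
  assumes "tame f" shows "integrable lborel (\<lambda>t. (cmod (f t))\<^sup>2)"
proof -
  have "integrable lborel (\<lambda>t. f t * cnj (f t))"
    by (intro tame_integrable tame_prod tame_cnj assms)
  then have "integrable lborel (\<lambda>t. Re (f t * cnj (f t)))" by (rule integrable_Re)
  moreover have "Re (f t * cnj (f t)) = (cmod (f t))\<^sup>2" for t
    by (simp add: cmod_power2) (simp add: power2_eq_square)
  ultimately show ?thesis by simp
qed

lemma tame_integrable_cis: "tame f \<Longrightarrow> integrable lborel (\<lambda>t. f t * cis (k * t * s))"
  by (rule tame_integrable, rule tame_mult[where K = 1]) auto

lemma FT_measurable [measurable]:
  assumes [measurable]: "f \<in> borel_measurable borel"
  shows "FT f \<in> borel_measurable borel"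
  unfolding FT_def by measurable

lemma FT_add: "tame f \<Longrightarrow> tame g \<Longrightarrow> FT (\<lambda>t. f t + g t) s = FT f s + FT g s"
  unfolding FT_def distrib_right by (intro Bochner_Integration.integral_add tame_integrable_cis)

lemma FT_cmult: "FT (\<lambda>t. c * f t) s = c * FT f s"
  unfolding FT_def by (simp add: mult.assoc)

lemma cmod_FT_le: "cmod (FT f s) \<le> (LINT t|lborel. cmod (f t))"
  unfolding FT_def by (rule order_trans[OF integral_norm_bound]) (simp add: norm_mult)

lemma FT_shift:
  "FT (\<lambda>t. f (t + a)) s = cis (- 2 * pi * a * s) * FT f s"
proof -
  have "FT f s = (LINT t|lborel. f (a + 1 * t) * cis (2 * pi * (a + 1 * t) * s))"
    unfolding FT_def using lborel_integral_real_affine[of 1 "\<lambda>t. f t * cis (2 * pi * t * s)" a] by simp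
  also have "\<dots> = (LINT t|lborel. cis (2 * pi * a * s) * (f (t + a) * cis (2 * pi * t * s)))"
    by (intro Bochner_Integration.integral_cong) (auto simp: cis_mult algebra_simps)
  also have "\<dots> = cis (2 * pi * a * s) * FT (\<lambda>t. f (t + a)) s"
    unfolding FT_def by simp
  finally show ?thesis by (simp add: cis_mult flip: mult.assoc)
qed

section \<open>Nonnegative series as integrals over counting measure\<close>

lemma nn_sum_shift: "(\<integral>\<^sup>+k. f (k + j) \<partial>count_space (UNIV::int set)) = (\<integral>\<^sup>+k. f k \<partial>count_space UNIV)"
proof (rule nn_integral_bij_count_space)
  show "bij_betw (\<lambda>k. k + j) UNIV (UNIV::int set)"
    by (rule bij_betwI[where g = "\<lambda>k. k - j"]) auto
qed

text \<open>Links \<open>infsum\<close>, in which frames are defined, to extended nonnegative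
  integrals, where Tonelli's theorem interchanges sums and integrals without any summability
  condition.\<close>

lemma nn_sum_summable:
  fixes u :: "'a \<Rightarrow> real"
  assumes "\<And>x. 0 \<le> u x" "u summable_on UNIV"
  shows "(\<integral>\<^sup>+x. ennreal (u x) \<partial>count_space UNIV) = ennreal (infsum u UNIV)"
proof -
  have "integrable (count_space UNIV) u"
    using assms abs_summable_equivalent[of u UNIV] by (simp add: Infinite_Set_Sum.abs_summable_on_def)
  then show ?thesis
    using assms infsetsum_infsum[of u UNIV]
    by (subst nn_integral_eq_integral) (auto simp: infsetsum_def Infinite_Set_Sum.abs_summable_on_def)
qed

lemma nn_sum_finite_imp_summable:
  fixes u :: "'a \<Rightarrow> real"
  assumes "\<And>x. 0 \<le> u x" "(\<integral>\<^sup>+x. ennreal (u x) \<partial>count_space UNIV) < \<infinity>"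
  shows "u summable_on UNIV"
proof -
  have "integrable (count_space UNIV) u"
    using assms by (intro integrableI_nonneg) auto
  then show ?thesis
    using abs_summable_equivalent[of u UNIV] abs_summable_summable[of u UNIV]
    by (simp add: Infinite_Set_Sum.abs_summable_on_def)
qed

lemma nn_sum_le_finite_sums:
  fixes u :: "'a \<Rightarrow> real"
  assumes "\<And>x. 0 \<le> u x" "\<And>A. finite A \<Longrightarrow> sum u A \<le> B"
  shows "(\<integral>\<^sup>+x. ennreal (u x) \<partial>count_space UNIV) \<le> ennreal B"
proof -
  have "u summable_on UNIV"
    using assms by (intro nonneg_bdd_above_summable_on bdd_aboveI[of _ B]) auto
  then show ?thesis
    using assms by (subst nn_sum_summable) (auto intro!: ennreal_leI infsum_le_finite_sums)
qed

lemma sum_le_nn_sum: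
  fixes u :: "'a \<Rightarrow> real"
  assumes "\<And>x. 0 \<le> u x" "finite A"
  shows "ennreal (sum u A) \<le> (\<integral>\<^sup>+x. ennreal (u x) \<partial>count_space UNIV)"
proof -
  have "ennreal (sum u A) = (\<Sum>x\<in>A. ennreal (u x))" using assms by (subst sum_ennreal) auto
  also have "\<dots> = (\<integral>\<^sup>+x. ennreal (u x) \<partial>count_space A)"
    using assms by (simp add: nn_integral_count_space_finite)
  also have "\<dots> \<le> (\<integral>\<^sup>+x. ennreal (u x) \<partial>count_space UNIV)"
    by (auto simp: nn_integral_count_space_indicator intro!: nn_integral_mono split: split_indicator)
  finally show ?thesis .
qed

section \<open>Orthogonality of exponentials and the least-squares identity\<close>

lemma orthogonality:
  fixes L a :: real and n :: int
  assumes "L > 0"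
  shows "(LINT t|lborel. indicator {a..a+L} t *\<^sub>R cis (2 * pi * t * (n / L))) = of_real (if n = 0 then L else 0)"
proof (cases "n = 0")
  case True
  then show ?thesis using assms by (simp add: integral_scaleR_left scaleR_conv_of_real)
next
  case False
  define k where "k = 2 * pi * (n / L)"
  have k: "k \<noteq> 0" using False assms by (simp add: k_def)
  have "(LINT t|lborel. indicator {a..a+L} t *\<^sub>R cis (2 * pi * t * (n / L))) = (LINT t|lborel. indicator {a..a+L} t *\<^sub>R cis (k * t))"
    by (simp add: k_def algebra_simps)
  also have "\<dots> = cis (k * (a + L)) / (\<i> * k) - cis (k * a) / (\<i> * k)"
  proof (intro integral_FTC_Icc continuous_intros)
    fix x :: real
    have "((\<lambda>z. exp (c * z) / c) has_field_derivative exp (c * of_real x)) (at (of_real x))" if "c \<noteq> 0" for c :: complex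
      using that by (auto intro!: derivative_eq_intros)
    from this[of "\<i> * k"] k
    have "((\<lambda>z. exp (\<i> * (k * z)) / (\<i> * k)) has_field_derivative exp (\<i> * (k * of_real x))) (at (of_real x))"
      by (simp add: mult.assoc)
    from has_vector_derivative_real_field[OF this, of "{a..a+L}"]
    show "((\<lambda>x. cis (k * x) / (\<i> * k)) has_vector_derivative cis (k * x)) (at x within {a..a+L})"
      by (simp add: cis_conv_exp)
  qed (use assms in auto)
  also have "cis (k * (a + L)) = cis (k * a)"
  proof -
    have "k * (a + L) = k * a + 2 * pi * n" using assms by (simp add: k_def field_simps)
    then show ?thesis by (simp flip: cis_mult add: cis_multiple_2pi)
  qed
  finally show ?thesis using False by simp
qed

text \<open>Expand the square, use orthogonality on the interval and complete the square in each
  \<open>d n\<close>. Taking \<open>d n\<close> to be the Fourier coefficient gives Bessel's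
  inequality; leaving \<open>d\<close> arbitrary shows that a good approximation by any
  trigonometric polynomial makes the Bessel defect small. \<open>parseval\<close> uses both.\<close>

lemma fourier_approx_identity:
  fixes L a :: real and d :: "int \<Rightarrow> complex"
  assumes L: "L > 0" and h: "tame h" and supp: "\<And>t. t \<notin> {a..a+L} \<Longrightarrow> h t = 0" and A: "finite A"
  defines "q \<equiv> \<lambda>t. indicator {a..a+L} t * (\<Sum>n\<in>A. d n * cis (- (2 * pi * t * (n / L))))"
  shows "(LINT t|lborel. (cmod (h t - q t))\<^sup>2) =
     (LINT t|lborel. (cmod (h t))\<^sup>2) - (\<Sum>n\<in>A. (cmod (FT h (n / L)))\<^sup>2) / L
       + L * (\<Sum>n\<in>A. (cmod (d n - FT h (n / L) / L))\<^sup>2)"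
proof -
  define e where "e = (\<lambda>(n::int) t. cis (2 * pi * t * (n / L)))"
  have [measurable]: "e n \<in> borel_measurable borel" for n unfolding e_def by measurable
  have q: "q t = (\<Sum>n\<in>A. d n * (indicator {a..a+L} t * cnj (e n t)))" for t
    by (simp add: q_def e_def sum_distrib_left cis_cnj mult_ac)
  have te: "tame (\<lambda>t. indicator {a..a+L} t * cnj (e n t))" for n
    by (rule tame_mult[where K = 1]) (measurable, auto simp: tame_indicator_Icc, simp add: e_def)
  have tq: "tame q" unfolding q by (intro tame_sum tame_cmult te A)
  have he: "(LINT t|lborel. h t * e n t) = FT h (n / L)" for n by (simp add: FT_def e_def)
  have the: "tame (\<lambda>t. h t * e n t)" for n
    by (rule tame_mult[where K = 1]) (auto simp: h, simp add: e_def)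
  have hq: "(LINT t|lborel. h t * cnj (q t)) = (\<Sum>n\<in>A. cnj (d n) * FT h (n / L))"
  proof -
    have "h t * cnj (q t) = (\<Sum>n\<in>A. cnj (d n) * (h t * e n t))" for t
      using supp[of t] by (cases "t \<in> {a..a+L}") (auto simp: q sum_distrib_left mult_ac intro!: sum.cong)
    then have "(LINT t|lborel. h t * cnj (q t)) = (\<Sum>n\<in>A. LINT t|lborel. cnj (d n) * (h t * e n t))"
      by (simp only:) (intro Bochner_Integration.integral_sum tame_integrable tame_cmult the)
    then show ?thesis by (simp add: he)
  qed
  have qq: "(LINT t|lborel. q t * cnj (q t)) = (\<Sum>n\<in>A. of_real (L * (cmod (d n))\<^sup>2))"
  proof -
    have i: "tame (\<lambda>t. d n * cnj (d m) * (indicator {a..a+L} t * e (m - n) t))" for n m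
      using te[of "n - m"] by (intro tame_cmult) (simp add: e_def cis_cnj algebra_simps minus_divide_left)
    have "q t * cnj (q t) = (\<Sum>n\<in>A. \<Sum>m\<in>A. d n * cnj (d m) * (indicator {a..a+L} t * e (m - n) t))" for t
      unfolding q cnj_sum sum_product
      by (intro sum.cong refl) (auto simp: e_def cis_cnj cis_mult indicator_def diff_divide_distrib algebra_simps)
    then have "(LINT t|lborel. q t * cnj (q t)) = (\<Sum>n\<in>A. \<Sum>m\<in>A. LINT t|lborel. d n * cnj (d m) * (indicator {a..a+L} t * e (m - n) t))"
      by (simp only:) (subst Bochner_Integration.integral_sum, intro Bochner_Integration.integrable_sum tame_integrable i,
          intro sum.cong refl Bochner_Integration.integral_sum tame_integrable i)
    also have "\<dots> = (\<Sum>n\<in>A. \<Sum>m\<in>A. d n * cnj (d m) * of_real (if m - n = 0 then L else 0))"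
    proof (intro sum.cong refl)
      fix n m
      have "(LINT t|lborel. indicator {a..a+L} t * e (m - n) t) = (LINT t|lborel. indicator {a..a+L} t *\<^sub>R cis (2 * pi * t * ((m - n) / L)))"
        by (intro Bochner_Integration.integral_cong) (auto simp: indicator_def e_def)
      also have "\<dots> = of_real (if m - n = 0 then L else 0)"
        using orthogonality[OF L, of a "m - n"] by simp
      finally show "(LINT t|lborel. d n * cnj (d m) * (indicator {a..a+L} t * e (m - n) t)) = d n * cnj (d m) * of_real (if m - n = 0 then L else 0)"
        by simp
    qed
    also have "\<dots> = (\<Sum>n\<in>A. of_real (L * (cmod (d n))\<^sup>2))"
    proof (intro sum.cong refl)
      fix n assume n: "n \<in> A"
      have "(\<Sum>m\<in>A. d n * cnj (d m) * of_real (if m - n = 0 then L else 0)) = (\<Sum>m\<in>A. if m = n then d n * cnj (d n) * L else 0)"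
        by (intro sum.cong) auto
      also have "\<dots> = d n * cnj (d n) * L" using n A by simp
      finally show "(\<Sum>m\<in>A. d n * cnj (d m) * of_real (if m - n = 0 then L else 0)) = of_real (L * (cmod (d n))\<^sup>2)"
        using complex_norm_square[of "d n"] by (simp add: mult.commute)
    qed
    finally show ?thesis .
  qed
  have "(cmod (h t - q t))\<^sup>2 = (cmod (h t))\<^sup>2 - 2 * Re (h t * cnj (q t)) + Re (q t * cnj (q t))" for t
    by (simp add: cmod_power2) (simp add: power2_eq_square algebra_simps)
  then have "(LINT t|lborel. (cmod (h t - q t))\<^sup>2) = (LINT t|lborel. (cmod (h t))\<^sup>2 - 2 * Re (h t * cnj (q t)) + Re (q t * cnj (q t)))"
    by simp
  also have "\<dots> = (LINT t|lborel. (cmod (h t))\<^sup>2) - 2 * Re (LINT t|lborel. h t * cnj (q t)) + Re (LINT t|lborel. q t * cnj (q t))"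
  proof -
    have "integrable lborel (\<lambda>t. (cmod (h t))\<^sup>2)" by (rule tame_square_integrable[OF h])
    moreover have "integrable lborel (\<lambda>t. h t * cnj (q t))" "integrable lborel (\<lambda>t. q t * cnj (q t))"
      by (intro tame_integrable tame_prod tame_cnj h tq)+
    ultimately show ?thesis
      by (simp del: times_complex.sel)
  qed
  also have "\<dots> = (LINT t|lborel. (cmod (h t))\<^sup>2) + (\<Sum>n\<in>A. L * (cmod (d n))\<^sup>2 - 2 * Re (cnj (d n) * FT h (n / L)))"
    unfolding hq qq by (simp add: sum_subtractf sum_distrib_left)
  also have "(\<Sum>n\<in>A. L * (cmod (d n))\<^sup>2 - 2 * Re (cnj (d n) * FT h (n / L))) =
     (\<Sum>n\<in>A. L * (cmod (d n - FT h (n / L) / L))\<^sup>2 - (cmod (FT h (n / L)))\<^sup>2 / L)"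
  proof (intro sum.cong refl)
    \<comment> \<open>Completing the square: \<open>c\<close> is the optimal coefficient, and the
      transform value is \<open>L\<close> times it.\<close>
    fix n :: int
    define c where "c = FT h (n / L) / L"
    have c: "FT h (n / L) = of_real L * c" using L by (simp add: c_def)
    show "L * (cmod (d n))\<^sup>2 - 2 * Re (cnj (d n) * FT h (n / L)) =
        L * (cmod (d n - FT h (n / L) / L))\<^sup>2 - (cmod (FT h (n / L)))\<^sup>2 / L"
      unfolding c using L by (simp add: cmod_power2 norm_mult power_mult_distrib) (simp add: power2_eq_square field_simps)
  qed
  finally show ?thesis by (simp add: sum_subtractf sum_distrib_left sum_divide_distrib)
qed

subsection \<open>Parseval's identity for Fourier series\<close>

definition trig_poly :: "real \<Rightarrow> (real \<Rightarrow> complex) \<Rightarrow> bool" where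
  "trig_poly L p \<longleftrightarrow> (\<exists>A d. finite A \<and> p = (\<lambda>t. \<Sum>n\<in>(A::int set). d n * cis (- (2 * pi * t * (n / L)))))"

lemma trig_poly_monom: "trig_poly L (\<lambda>t. c * cis (- (2 * pi * t * (of_int n / L))))"
  unfolding trig_poly_def by (intro exI[of _ "{n}"] exI[of _ "\<lambda>_. c"]) simp

lemma trig_poly_add:
  assumes "trig_poly L p" "trig_poly L q"
  shows "trig_poly L (\<lambda>t. p t + q t)"
proof -
  obtain A d where A: "finite A" "p = (\<lambda>t. \<Sum>n\<in>A. d n * cis (- (2 * pi * t * (of_int n / L))))"
    using assms unfolding trig_poly_def by blast
  obtain B e where B: "finite B" "q = (\<lambda>t. \<Sum>n\<in>B. e n * cis (- (2 * pi * t * (of_int n / L))))"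
    using assms unfolding trig_poly_def by blast
  let ?d = "\<lambda>n. (if n \<in> A then d n else 0) + (if n \<in> B then e n else 0)"
  have 1: "(\<Sum>n\<in>A \<union> B. (if n \<in> A then d n else 0) * cis (- (2 * pi * t * (of_int n / L)))) = p t" for t
    unfolding A(2) using A(1) B(1) by (intro sum.mono_neutral_cong_right) auto
  have 2: "(\<Sum>n\<in>A \<union> B. (if n \<in> B then e n else 0) * cis (- (2 * pi * t * (of_int n / L)))) = q t" for t
    unfolding B(2) using A(1) B(1) by (intro sum.mono_neutral_cong_right) auto
  have "(\<lambda>t. p t + q t) = (\<lambda>t. \<Sum>n\<in>A \<union> B. ?d n * cis (- (2 * pi * t * (of_int n / L))))"
    by (simp only: distrib_right sum.distrib 1 2)
  then show ?thesis unfolding trig_poly_def using A(1) B(1) by (intro exI[of _ "A \<union> B"] exI[of _ ?d]) auto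
qed

lemma trig_poly_sum:
  "finite A \<Longrightarrow> (\<And>k. k \<in> A \<Longrightarrow> trig_poly L (p k)) \<Longrightarrow> trig_poly L (\<lambda>t. \<Sum>k\<in>A. p k t)"
proof (induction A rule: finite_induct)
  case empty
  show ?case using trig_poly_monom[of L 0] by simp
qed (simp add: trig_poly_add)

lemma trig_poly_mult:
  assumes "trig_poly L p" "trig_poly L q"
  shows "trig_poly L (\<lambda>t. p t * q t)"
proof -
  obtain A d where A: "finite A" "p = (\<lambda>t. \<Sum>n\<in>A. d n * cis (- (2 * pi * t * (of_int n / L))))"
    using assms unfolding trig_poly_def by blast
  obtain B e where B: "finite B" "q = (\<lambda>t. \<Sum>n\<in>B. e n * cis (- (2 * pi * t * (of_int n / L))))"
    using assms unfolding trig_poly_def by blast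
  have "(\<lambda>t. p t * q t) = (\<lambda>t. \<Sum>n\<in>A. \<Sum>m\<in>B. d n * e m * cis (- (2 * pi * t * (of_int (n + m) / L))))"
    unfolding A B sum_product
    by (intro ext sum.cong refl) (simp add: cis_mult add_divide_distrib algebra_simps)
  then show ?thesis by (simp only:) (intro trig_poly_sum A(1) B(1) trig_poly_monom)
qed

lemma trig_poly_const: "trig_poly L (\<lambda>t. c)"
  using trig_poly_monom[of L c 0] by simp

text \<open>A real-linear functional on the plane, evaluated at \<open>cis x\<close>, is a
  combination of cos x and sin x, hence of \<open>cis x\<close> and \<open>cis (- x)\<close>. Sums
  and products preserve trigonometric polynomials, so induction on the polynomial finishes.\<close>

lemma trig_poly_circle:
  assumes "real_polynomial_function r"
  shows "trig_poly L (\<lambda>t. of_real (r (cis (2 * pi * t / L))))"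
  using assms
proof (induction rule: real_polynomial_function.induct)
  case (linear f)
  then interpret bounded_linear f .
  have "complex_of_real (f (cis x)) = (of_real (f 1) / 2 - of_real (f \<i>) / (2 * \<i>)) * cis (- x) + (of_real (f 1) / 2 + of_real (f \<i>) / (2 * \<i>)) * cis x" for x
  proof -
    have "cis x = cos x *\<^sub>R 1 + sin x *\<^sub>R \<i>" by (simp add: complex_eq_iff)
    then have "f (cis x) = cos x * f 1 + sin x * f \<i>" by (simp only: add scaleR) simp
    then show ?thesis by (simp add: complex_eq_iff field_simps)
  qed
  then have "(\<lambda>t. complex_of_real (f (cis (2 * pi * t / L)))) = (\<lambda>t. (of_real (f 1) / 2 - of_real (f \<i>) / (2 * \<i>)) * cis (- (2 * pi * t * (of_int 1 / L))) + (of_real (f 1) / 2 + of_real (f \<i>) / (2 * \<i>)) * cis (- (2 * pi * t * (of_int (-1) / L))))"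
    by simp
  then show ?case by (simp only:) (intro trig_poly_add trig_poly_monom)
qed (simp_all add: trig_poly_const trig_poly_add trig_poly_mult)

text \<open>Gluing the endpoints turns the interval into a circle, so that Stone-Weierstrass on the
  compact unit circle becomes available for periodic functions.\<close>

lemma circle_lift:
  fixes G :: "real \<Rightarrow> complex"
  assumes L: "L > 0" and G: "continuous_on {a..a+L} G" and per: "G a = G (a + L)"
  obtains H where "continuous_on (sphere 0 1) H" "\<And>t. t \<in> {a..a+L} \<Longrightarrow> H (cis (2 * pi * t / L)) = G t"
proof -
  define \<phi> where "\<phi> t = cis (2 * pi * t / L)" for t
  \<comment> \<open>Points with the same image differ by an integer multiple of \<open>L\<close>.
    Inside an interval of length \<open>L\<close>, two distinct such points must be its endpoints,
    where \<open>per\<close> applies.\<close>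
  have eq: "G s = G t" if st: "s \<in> {a..a+L}" "t \<in> {a..a+L}" "\<phi> s = \<phi> t" for s t
  proof -
    from st(3) have "cos (2 * pi * s / L) = cos (2 * pi * t / L) \<and> sin (2 * pi * s / L) = sin (2 * pi * t / L)"
      by (auto simp: \<phi>_def complex_eq_iff)
    then obtain k where "2 * pi * s / L = 2 * pi * t / L + 2 * pi * of_int k"
      using sin_cos_eq_iff[of "2 * pi * s / L" "2 * pi * t / L"] by auto
    then have "2 * pi * s = 2 * pi * (t + L * of_int k)" using L by (simp add: field_simps)
    then have k: "s = t + L * of_int k" by simp
    then have "\<bar>L * of_int k\<bar> \<le> L * 1" using st by auto
    then have "\<bar>real_of_int k\<bar> \<le> 1" using L by (simp add: abs_mult)
    then have "k = -1 \<or> k = 0 \<or> k = 1" by linarith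
    then have "s = t \<or> (s = a \<and> t = a + L) \<or> (t = a \<and> s = a + L)"
      using k st by auto
    then show ?thesis using per by auto
  qed
  have surj: "\<exists>t\<in>{a..a+L}. \<phi> t = z" if "z \<in> sphere 0 1" for z
  proof -
    define \<theta> where "\<theta> = Arg2pi z"
    have z: "z = cis \<theta>" using that complex_norm_eq_1_exp[of z] by (simp add: cis_conv_exp \<theta>_def)
    define u where "u = \<theta> * L / (2 * pi)"
    define k where "k = \<lceil>(a - u) / L\<rceil>"
    have "(a - u) / L \<le> k" "k < (a - u) / L + 1" unfolding k_def by linarith+
    then have "u + L * k \<in> {a..a+L}" using L by (simp add: field_simps)
    moreover have "\<phi> (u + L * k) = z"
    proof -
      have "2 * pi * (u + L * k) / L = \<theta> + 2 * pi * k" using L by (simp add: u_def field_simps)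
      then show ?thesis unfolding \<phi>_def z by (simp flip: cis_mult add: cis_multiple_2pi)
    qed
    ultimately show ?thesis by blast
  qed
  define H where "H z = G (SOME t. t \<in> {a..a+L} \<and> \<phi> t = z)" for z
  have H: "H (\<phi> t) = G t" if "t \<in> {a..a+L}" for t
  proof -
    have "(SOME s. s \<in> {a..a+L} \<and> \<phi> s = \<phi> t) \<in> {a..a+L} \<and> \<phi> (SOME s. s \<in> {a..a+L} \<and> \<phi> s = \<phi> t) = \<phi> t"
      by (rule someI[of _ t]) (use that in auto)
    then show ?thesis unfolding H_def using that by (intro eq) auto
  qed
  have cphi: "continuous_on UNIV \<phi>" unfolding \<phi>_def using L by (intro continuous_intros) auto
  have "continuous_on (sphere 0 1) H"
    unfolding continuous_on_closed_vimage[OF closed_sphere]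
  proof (intro allI impI)
    fix B :: "complex set" assume B: "closed B"
    \<comment> \<open>The interval map is a quotient map: a preimage under \<open>H\<close> is the
      image of a preimage under \<open>G\<close>, and that image is compact, hence closed.\<close>
    have "H -` B \<inter> sphere 0 1 = \<phi> ` (G -` B \<inter> {a..a+L})"
    proof (intro set_eqI iffI)
      fix z assume "z \<in> H -` B \<inter> sphere 0 1"
      then show "z \<in> \<phi> ` (G -` B \<inter> {a..a+L})" using surj[of z] H by force
    next
      fix z assume "z \<in> \<phi> ` (G -` B \<inter> {a..a+L})"
      then show "z \<in> H -` B \<inter> sphere 0 1" using H by (auto simp: \<phi>_def)
    qed
    moreover have "closed (G -` B \<inter> {a..a+L})"
      using G B continuous_on_closed_vimage[of "{a..a+L}" G] by auto
    then have "compact (G -` B \<inter> {a..a+L})"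
      using compact_Int_closed[of "{a..a+L}" "G -` B \<inter> {a..a+L}"] by (simp add: Int_absorb1)
    then have "compact (\<phi> ` (G -` B \<inter> {a..a+L}))"
      using cphi by (intro compact_continuous_image continuous_on_subset[OF cphi]) auto
    ultimately show "closed (H -` B \<inter> sphere 0 1)" by (simp add: compact_imp_closed)
  qed
  then show ?thesis using H that unfolding \<phi>_def by blast
qed

lemma trig_poly_uniform_approx:
  fixes G :: "real \<Rightarrow> complex"
  assumes L: "L > 0" and G: "continuous_on {a..a+L} G" and per: "G a = G (a + L)" and e: "e > 0"
  shows "\<exists>p. trig_poly L p \<and> (\<forall>t\<in>{a..a+L}. cmod (G t - p t) < e)"
proof -
  obtain H where H: "continuous_on (sphere 0 1) H" "\<And>t. t \<in> {a..a+L} \<Longrightarrow> H (cis (2 * pi * t / L)) = G t"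
    using circle_lift[OF L G per] by blast
  obtain g where g: "polynomial_function g" "\<And>z. z \<in> sphere 0 1 \<Longrightarrow> norm (H z - g z) < e"
    using Stone_Weierstrass_polynomial_function[OF compact_sphere H(1) e] by blast
  have "real_polynomial_function (\<lambda>x. Re (g x))" "real_polynomial_function (\<lambda>x. Im (g x))"
    using g(1) bounded_linear_Re bounded_linear_Im unfolding polynomial_function_def o_def by blast+
  then have "trig_poly L (\<lambda>t. of_real (Re (g (cis (2 * pi * t / L)))) + \<i> * of_real (Im (g (cis (2 * pi * t / L)))))"
    by (intro trig_poly_add trig_poly_mult trig_poly_const trig_poly_circle[of "\<lambda>x. Re (g x)"] trig_poly_circle[of "\<lambda>x. Im (g x)"])
  then have "trig_poly L (\<lambda>t. g (cis (2 * pi * t / L)))"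
    by (simp flip: complex_eq)
  moreover have "cmod (G t - g (cis (2 * pi * t / L))) < e" if "t \<in> {a..a+L}" for t
    using g(2)[of "cis (2 * pi * t / L)"] H(2)[OF that] by simp
  ultimately show ?thesis by blast
qed

text \<open>Three reductions: measurable to continuous by almost everywhere approximation and
  dominated convergence, continuous to periodic by a cutoff at the endpoints, periodic to
  trigonometric by uniform approximation.\<close>

lemma trig_poly_L2_approx:
  assumes L: "L > 0" and h: "tame h" and supp: "\<And>t. t \<notin> {a..a+L} \<Longrightarrow> h t = 0" and e: "e > 0"
  shows "\<exists>p. trig_poly L p \<and> (LINT t|lborel. (cmod (h t - indicator {a..a+L} t * p t))\<^sup>2) < e"
proof -
  have [measurable]: "h \<in> borel_measurable borel" using h by (simp add: tame_def)
  obtain R where R: "\<And>t. cmod (h t) \<le> R" using h by (auto simp: tame_def)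
  have R0: "R \<ge> 0" using R[of 0] norm_ge_zero order_trans by blast
  have "h measurable_on UNIV"
    by (intro lebesgue_measurable_imp_measurable_on) (auto intro: measurable_completion)
  then obtain N g where N: "negligible N" and g: "\<And>n. continuous_on UNIV (g n)"
    and lim: "\<And>t. t \<notin> N \<Longrightarrow> (\<lambda>n::nat. g n t) \<longlonglongrightarrow> h t"
    unfolding measurable_on_def by auto
  \<comment> \<open>The continuous approximants need not be bounded. Projecting their values onto
    the closed disc of radius \<open>R\<close> keeps continuity, fixes the values of
    \<open>h\<close>, and provides a dominating function.\<close>
  define cp where "cp = closest_point (cball (0::complex) R)"
  have cp_cont: "continuous_on UNIV cp" unfolding cp_def using R0 by (intro continuous_on_closest_point) auto
  have cp_norm: "cmod (cp z) \<le> R" for z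
    using closest_point_in_set[of "cball (0::complex) R" z] R0 by (auto simp: cp_def)
  have cp_h: "cp (h t) = h t" for t unfolding cp_def using R[of t] by (intro closest_point_self) auto
  \<comment> \<open>A cutoff that vanishes at both endpoints, which makes \<open>G n\<close>
    periodic, and that equals 1 at each interior point once \<open>n\<close> is large.\<close>
  define \<phi> where "\<phi> n t = min 1 (real n * ((t - a) * (a + L - t)))" for n t
  define G where "G n t = \<phi> n t *\<^sub>R cp (g n t)" for n t
  have Gc: "continuous_on UNIV (G n)" for n
    unfolding G_def \<phi>_def
    by (intro continuous_intros continuous_on_compose2[OF cp_cont g]) auto
  then have [measurable]: "G n \<in> borel_measurable borel" for n
    by (intro borel_measurable_continuous_onI)
  have Gn: "cmod (G n t) \<le> R" if "t \<in> {a..a+L}" for n t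
  proof -
    have "0 \<le> real n * ((t - a) * (a + L - t))" using that by (intro mult_nonneg_nonneg) auto
    then have "\<bar>\<phi> n t\<bar> \<le> 1" unfolding \<phi>_def by linarith
    then show ?thesis unfolding G_def using mult_mono[of "\<bar>\<phi> n t\<bar>" 1 "cmod (cp (g n t))" R] cp_norm by simp
  qed
  have phil: "(\<lambda>n. \<phi> n t) \<longlonglongrightarrow> 1" if "t \<in> {a<..<a+L}" for t
  proof -
    have pos: "(t - a) * (a + L - t) > 0" using that by simp
    have "eventually (\<lambda>n. \<phi> n t = 1) sequentially"
    proof -
      obtain m :: nat where "1 < real m * ((t - a) * (a + L - t))"
        using reals_Archimedean3[OF pos] by blast
      then have "\<phi> n t = 1" if "n \<ge> m" for n
      proof -
        have "real m * ((t - a) * (a + L - t)) \<le> real n * ((t - a) * (a + L - t))"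
          using that pos by (intro mult_right_mono) auto
        with \<open>1 < _\<close> show ?thesis unfolding \<phi>_def by linarith
      qed
      then show ?thesis using eventually_sequentially by blast
    qed
    then show ?thesis by (rule tendsto_eventually)
  qed
  have "(\<lambda>n. LINT t|lborel. indicator {a..a+L} t * (cmod (h t - G n t))\<^sup>2) \<longlonglongrightarrow> (LINT t|(lborel :: real measure). (0::real))"
  proof (rule integral_dominated_convergence[where w = "\<lambda>t. indicat_real {a..a+L} t * (2 * R)\<^sup>2"])
    show "integrable lborel (\<lambda>t. indicat_real {a..a+L} t * (2 * R)\<^sup>2)"
      by (intro integrable_mult_left integrable_real_indicator) (auto simp: emeasure_lborel_Icc_eq)
    have "negligible (N \<union> {a, a + L})" using N by (simp add: negligible_Un_eq)
    then have "AE t in lebesgue. t \<notin> N \<union> {a, a+L}"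
      unfolding negligible_iff_null_sets by (rule AE_not_in)
    then have "AE t in lborel. t \<notin> N \<union> {a, a+L}"
      by (simp only: AE_completion_iff)
    then show "AE t in lborel. (\<lambda>n. indicat_real {a..a+L} t * (cmod (h t - G n t))\<^sup>2) \<longlonglongrightarrow> 0"
    proof eventually_elim
      case (elim t)
      show ?case
      proof (cases "t \<in> {a..a+L}")
        case True
        then have t: "t \<in> {a<..<a+L}" "t \<notin> N" using elim by auto
        have "(\<lambda>n. cp (g n t)) \<longlonglongrightarrow> cp (h t)"
          using cp_cont lim[OF t(2)] by (intro continuous_on_tendsto_compose[OF cp_cont]) auto
        then have "(\<lambda>n. G n t) \<longlonglongrightarrow> 1 *\<^sub>R h t" unfolding G_def cp_h by (intro tendsto_scaleR phil t)
        then have "(\<lambda>n. (cmod (h t - G n t))\<^sup>2) \<longlonglongrightarrow> (cmod (h t - 1 *\<^sub>R h t))\<^sup>2" by (intro tendsto_intros)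
        then show ?thesis using True by simp
      qed auto
    qed
    show "AE t in lborel. norm (indicat_real {a..a+L} t * (cmod (h t - G n t))\<^sup>2) \<le> indicat_real {a..a+L} t * (2 * R)\<^sup>2" for n
    proof (intro AE_I2)
      fix t
      show "norm (indicat_real {a..a+L} t * (cmod (h t - G n t))\<^sup>2) \<le> indicat_real {a..a+L} t * (2 * R)\<^sup>2"
      proof (cases "t \<in> {a..a+L}")
        case True
        have "cmod (h t - G n t) \<le> 2 * R"
          using norm_triangle_ineq4[of "h t" "G n t"] R[of t] Gn[OF True, of n] by linarith
        then have "(cmod (h t - G n t))\<^sup>2 \<le> (2 * R)\<^sup>2" by (intro power_mono) auto
        then show ?thesis using True by simp
      qed auto
    qed
  qed auto
  then have "eventually (\<lambda>n. (LINT t|lborel. indicator {a..a+L} t * (cmod (h t - G n t))\<^sup>2) < e / 4) sequentially"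
    using e by (intro order_tendstoD(2)[where a = "e/4"]) auto
  then obtain n where n: "(LINT t|lborel. indicator {a..a+L} t * (cmod (h t - G n t))\<^sup>2) < e / 4"
    by (meson eventually_sequentially order_refl)
  \<comment> \<open>Chosen so that a uniform error \<delta> costs e/4 in squared L2 norm. Both
    errors get doubled when the square of their sum is split, and together they stay below
    \<open>e\<close>.\<close>
  define \<delta> where "\<delta> = sqrt (e / (4 * L))"
  have \<delta>: "\<delta> > 0" "L * \<delta>\<^sup>2 = e / 4" using e L by (auto simp: \<delta>_def)
  have "G n a = G n (a + L)" by (simp add: G_def \<phi>_def)
  then obtain p where p: "trig_poly L p" "\<And>t. t \<in> {a..a+L} \<Longrightarrow> cmod (G n t - p t) < \<delta>"
    using trig_poly_uniform_approx[OF L continuous_on_subset[OF Gc] _ \<delta>(1)] by blast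
  have [measurable]: "p \<in> borel_measurable borel"
    using p(1) unfolding trig_poly_def by (auto intro!: borel_measurable_sum)
  have int: "integrable lborel (\<lambda>t. indicator {a..a+L} t * (cmod (h t - G n t))\<^sup>2)"
  proof -
    have "tame (\<lambda>t. indicator {a..a+L} t * (h t - G n t))"
    proof (rule tame_mult[OF tame_indicator_Icc, where K = "2 * R"])
      show "cmod (h t - G n t) \<le> 2 * R" if "indicator {a..a+L} t \<noteq> (0::complex)" for t
        using norm_triangle_ineq4[of "h t" "G n t"] R[of t] Gn[of t n] that by (auto simp: indicator_def split: if_splits)
    qed measurable
    note tame_square_integrable[OF this]
    also have "(\<lambda>t. (cmod (indicator {a..a+L} t * (h t - G n t)))\<^sup>2) = (\<lambda>t. indicator {a..a+L} t * (cmod (h t - G n t))\<^sup>2)"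
      by (auto simp: indicator_def)
    finally show ?thesis .
  qed
  have int2: "integrable lborel (\<lambda>t. indicat_real {a..a+L} t * \<delta>\<^sup>2)"
    by (intro integrable_mult_left integrable_real_indicator) (auto simp: emeasure_lborel_Icc_eq)
  have "(LINT t|lborel. (cmod (h t - indicator {a..a+L} t * p t))\<^sup>2) \<le>
      (LINT t|lborel. 2 * (indicator {a..a+L} t * (cmod (h t - G n t))\<^sup>2) + 2 * (indicat_real {a..a+L} t * \<delta>\<^sup>2))"
  proof (rule integral_mono_AE')
    show "AE t in lborel. (cmod (h t - indicator {a..a+L} t * p t))\<^sup>2 \<le> 2 * (indicator {a..a+L} t * (cmod (h t - G n t))\<^sup>2) + 2 * (indicat_real {a..a+L} t * \<delta>\<^sup>2)"
    proof (intro AE_I2)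
      fix t
      show "(cmod (h t - indicator {a..a+L} t * p t))\<^sup>2 \<le> 2 * (indicator {a..a+L} t * (cmod (h t - G n t))\<^sup>2) + 2 * (indicat_real {a..a+L} t * \<delta>\<^sup>2)"
      proof (cases "t \<in> {a..a+L}")
        case True
        have "(cmod (h t - p t))\<^sup>2 \<le> (cmod (h t - G n t) + cmod (G n t - p t))\<^sup>2"
          using norm_triangle_ineq[of "h t - G n t" "G n t - p t"] by (intro power_mono) auto
        also have "\<dots> \<le> 2 * (cmod (h t - G n t))\<^sup>2 + 2 * (cmod (G n t - p t))\<^sup>2"
          using sum_squares_bound[of "cmod (h t - G n t)" "cmod (G n t - p t)"] by (simp add: power2_sum)
        also have "(cmod (G n t - p t))\<^sup>2 \<le> \<delta>\<^sup>2" using p(2)[OF True] by (intro power_mono) auto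
        finally show ?thesis using True by simp
      qed (use supp in auto)
    qed
  qed (use int int2 in auto)
  also have "\<dots> = 2 * (LINT t|lborel. indicator {a..a+L} t * (cmod (h t - G n t))\<^sup>2) + 2 * (L * \<delta>\<^sup>2)"
    using int int2 L by simp
  also have "\<dots> < e" using n \<delta>(2) by simp
  finally show ?thesis using p(1) by blast
qed

theorem parseval:
  assumes L: "L > 0" and h: "tame h" and supp: "\<And>t. t \<notin> {a..a+L} \<Longrightarrow> h t = 0"
  shows "(\<integral>\<^sup>+n. ennreal ((cmod (FT h (of_int n / L)))\<^sup>2) \<partial>count_space UNIV) = ennreal L * (\<integral>\<^sup>+t. ennreal ((cmod (h t))\<^sup>2) \<partial>lborel)"
proof -
  define I where "I = (LINT t|lborel. (cmod (h t))\<^sup>2)"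
  have I0: "I \<ge> 0" unfolding I_def by simp
  have I: "(\<integral>\<^sup>+t. ennreal ((cmod (h t))\<^sup>2) \<partial>lborel) = ennreal I"
    unfolding I_def by (intro nn_integral_eq_integral tame_square_integrable h) auto
  note id = fourier_approx_identity[OF L h supp]
  have "(\<integral>\<^sup>+n. ennreal ((cmod (FT h (of_int n / L)))\<^sup>2) \<partial>count_space UNIV) = ennreal (L * I)"
  proof (rule antisym)
    show "(\<integral>\<^sup>+n. ennreal ((cmod (FT h (of_int n / L)))\<^sup>2) \<partial>count_space UNIV) \<le> ennreal (L * I)"
    proof (rule nn_sum_le_finite_sums)
      fix A :: "int set" assume A: "finite A"
      have "0 \<le> (LINT t|lborel. (cmod (h t - indicator {a..a+L} t * (\<Sum>n\<in>A. FT h (n / L) / L * cis (- (2 * pi * t * (n / L))))))\<^sup>2)"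
        by simp
      also have "\<dots> = I - (\<Sum>n\<in>A. (cmod (FT h (n / L)))\<^sup>2) / L"
        by (subst id[OF _ A]) (auto simp: I_def)
      finally show "(\<Sum>n\<in>A. (cmod (FT h (n / L)))\<^sup>2) \<le> L * I" using L by (simp add: field_simps)
    qed auto
    show "ennreal (L * I) \<le> (\<integral>\<^sup>+n. ennreal ((cmod (FT h (of_int n / L)))\<^sup>2) \<partial>count_space UNIV)"
    proof (rule ennreal_le_epsilon)
      fix e :: real assume e: "e > 0"
      obtain p where p: "trig_poly L p" "(LINT t|lborel. (cmod (h t - indicator {a..a+L} t * p t))\<^sup>2) < e / L"
        using trig_poly_L2_approx[OF L h supp, where e = "e / L"] e L by auto
      obtain A d where A: "finite A" "p = (\<lambda>t. \<Sum>n\<in>A. d n * cis (- (2 * pi * t * (of_int n / L))))"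
        using p(1) unfolding trig_poly_def by blast
      \<comment> \<open>The last term of the identity is nonnegative and is dropped, so the
        approximation error of \<open>p\<close> dominates the Bessel defect.\<close>
      have "I - (\<Sum>n\<in>A. (cmod (FT h (n / L)))\<^sup>2) / L \<le> (LINT t|lborel. (cmod (h t - indicator {a..a+L} t * p t))\<^sup>2)"
        unfolding A(2) using L by (subst id[OF _ A(1)]) (auto simp: I_def intro!: mult_nonneg_nonneg sum_nonneg)
      then have "L * I \<le> (\<Sum>n\<in>A. (cmod (FT h (n / L)))\<^sup>2) + e"
        using p(2) L by (simp add: field_simps)
      then have "ennreal (L * I) \<le> ennreal (\<Sum>n\<in>A. (cmod (FT h (n / L)))\<^sup>2) + ennreal e"
        using e by (subst ennreal_plus[symmetric]) (auto intro!: ennreal_leI sum_nonneg)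
      also have "\<dots> \<le> (\<integral>\<^sup>+n. ennreal ((cmod (FT h (of_int n / L)))\<^sup>2) \<partial>count_space UNIV) + ennreal e"
        using sum_le_nn_sum[of "\<lambda>n. (cmod (FT h (of_int n / L)))\<^sup>2" A] A(1) by (intro add_mono) auto
      finally show "ennreal (L * I) \<le> (\<integral>\<^sup>+n. ennreal ((cmod (FT h (of_int n / L)))\<^sup>2) \<partial>count_space UNIV) + ennreal e" .
    qed
  qed
  then show ?thesis using I I0 L by (simp add: ennreal_mult)
qed

subsection \<open>Plancherel's theorem and periodization\<close>

lemma nn_sum_swap:
  fixes f :: "int \<Rightarrow> 'a \<Rightarrow> ennreal"
  assumes "\<And>i. f i \<in> borel_measurable M"
  shows "(\<integral>\<^sup>+x. (\<integral>\<^sup>+i. f i x \<partial>count_space UNIV) \<partial>M) = (\<integral>\<^sup>+i. (\<integral>\<^sup>+x. f i x \<partial>M) \<partial>count_space UNIV)"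
  using assms by (intro nn_integral_count_space_nn_integral) auto

lemma nn_sum_measurable [measurable (raw)]:
  fixes f :: "int \<Rightarrow> 'a \<Rightarrow> ennreal"
  assumes [measurable]: "\<And>i. f i \<in> borel_measurable M"
  shows "(\<lambda>x. \<integral>\<^sup>+i. f i x \<partial>count_space UNIV) \<in> borel_measurable M"
proof -
  interpret sigma_finite_measure "count_space (UNIV :: int set)"
    by (rule sigma_finite_measure_count_space)
  show ?thesis
  proof (rule borel_measurable_nn_integral)
    show "(\<lambda>(x, i). f i x) \<in> borel_measurable (M \<Otimes>\<^sub>M count_space UNIV)"
      unfolding split_beta' by (rule measurable_compose_countable[where g = snd]) measurable
  qed
qed

lemma tile_index:
  fixes p :: real
  assumes "p > 0"
  shows "x \<in> {of_int n * p..<(of_int n + 1) * p} \<longleftrightarrow> n = \<lfloor>x / p\<rfloor>"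
proof -
  have "n = \<lfloor>x / p\<rfloor> \<longleftrightarrow> of_int n \<le> x / p \<and> x / p < of_int n + 1"
    by (metis floor_eq_iff)
  then show ?thesis using assms by (simp add: pos_le_divide_eq pos_divide_less_eq)
qed

text \<open>The half-open intervals of length \<open>p\<close> partition the line, and exactly one
  of them contains a given point; Tonelli and translation move all of them to the first one.\<close>

lemma nn_integral_tiling:
  fixes p :: real
  assumes p: "p > 0" and [measurable]: "u \<in> borel_measurable borel"
  shows "(\<integral>\<^sup>+x. u x \<partial>lborel) = (\<integral>\<^sup>+x. indicator {0..<p} x * (\<integral>\<^sup>+n. u (x + of_int n * p) \<partial>count_space UNIV) \<partial>lborel)"
proof -
  have "(\<integral>\<^sup>+x. u x \<partial>lborel) = (\<integral>\<^sup>+x. (\<integral>\<^sup>+n. u x * indicator {of_int n * p..<(of_int n + 1) * p} x \<partial>count_space (UNIV :: int set)) \<partial>lborel)"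
  proof (rule nn_integral_cong)
    fix x
    have "indicator {of_int n * p..<(of_int n + 1) * p} x = (indicator {\<lfloor>x / p\<rfloor>} n :: ennreal)" for n :: int
      using tile_index[OF p, of x n] by (simp add: indicator_def)
    then show "u x = (\<integral>\<^sup>+n. u x * indicator {of_int n * p..<(of_int n + 1) * p} x \<partial>count_space (UNIV :: int set))"
      by (simp add: nn_integral_cmult_indicator)
  qed
  also have "\<dots> = (\<integral>\<^sup>+n. (\<integral>\<^sup>+x. u x * indicator {of_int n * p..<(of_int n + 1) * p} x \<partial>lborel) \<partial>count_space (UNIV :: int set))"
    by (rule nn_sum_swap) measurable
  also have "\<dots> = (\<integral>\<^sup>+n. (\<integral>\<^sup>+x. indicator {0..<p} x * u (x + of_int n * p) \<partial>lborel) \<partial>count_space (UNIV :: int set))"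
  proof (rule nn_integral_cong)
    fix n :: int
    have "(\<integral>\<^sup>+x. u x * indicator {of_int n * p..<(of_int n + 1) * p} x \<partial>lborel) =
      (\<integral>\<^sup>+x. u (of_int n * p + 1 * x) * indicator {of_int n * p..<(of_int n + 1) * p} (of_int n * p + 1 * x) \<partial>lborel)"
      by (subst nn_integral_real_affine[where c = 1 and t = "of_int n * p"]) auto
    also have "\<dots> = (\<integral>\<^sup>+x. indicator {0..<p} x * u (x + of_int n * p) \<partial>lborel)"
      by (intro nn_integral_cong) (auto simp: indicator_def algebra_simps)
    finally show "(\<integral>\<^sup>+x. u x * indicator {of_int n * p..<(of_int n + 1) * p} x \<partial>lborel) = (\<integral>\<^sup>+x. indicator {0..<p} x * u (x + of_int n * p) \<partial>lborel)" .
  qed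
  also have "\<dots> = (\<integral>\<^sup>+x. (\<integral>\<^sup>+n. indicator {0..<p} x * u (x + of_int n * p) \<partial>count_space (UNIV :: int set)) \<partial>lborel)"
    by (rule nn_sum_swap[symmetric]) measurable
  finally show ?thesis by (simp add: nn_integral_cmult)
qed

text \<open>Tile the frequency axis with step \<open>1/L\<close>, where an interval of length
  \<open>L\<close> contains the support. By Parseval every coset of the lattice carries the same
  energy, \<open>L\<close> times that of \<open>f\<close>, and the cosets are parametrized by an
  interval of length \<open>1/L\<close>.\<close>

lemma plancherel:
  assumes f: "tame f"
  shows "(\<integral>\<^sup>+s. ennreal ((cmod (FT f s))\<^sup>2) \<partial>lborel) = (\<integral>\<^sup>+t. ennreal ((cmod (f t))\<^sup>2) \<partial>lborel)"
proof -
  have [measurable]: "f \<in> borel_measurable borel" using f by (simp add: tame_def)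
  obtain R where R: "\<And>t. cmod (f t) \<le> R" "\<And>t. f t \<noteq> 0 \<Longrightarrow> \<bar>t\<bar> \<le> R" using f by (auto simp: tame_def)
  have R0: "R \<ge> 0" using R(1)[of 0] norm_ge_zero order_trans by blast
  \<comment> \<open>The added 1 keeps the period positive even if \<open>R = 0\<close>.\<close>
  define L where "L = 2 * R + 1"
  have L: "L > 0" using R0 by (simp add: L_def)
  have supp: "f t = 0" if "t \<notin> {-R..-R+L}" for t
    using R(2)[of t] that R0 by (cases "f t = 0") (auto simp: L_def abs_le_iff)
  have "(\<integral>\<^sup>+s. ennreal ((cmod (FT f s))\<^sup>2) \<partial>lborel) =
    (\<integral>\<^sup>+s. indicator {0..<1/L} s * (\<integral>\<^sup>+n. ennreal ((cmod (FT f (s + of_int n * (1/L))))\<^sup>2) \<partial>count_space UNIV) \<partial>lborel)"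
    using L by (intro nn_integral_tiling) auto
  also have "\<dots> = (\<integral>\<^sup>+s. indicator {0..<1/L} s * (ennreal L * (\<integral>\<^sup>+t. ennreal ((cmod (f t))\<^sup>2) \<partial>lborel)) \<partial>lborel)"
  proof (intro nn_integral_cong arg_cong2[where f = "(*)"] refl)
    fix s
    define h where "h t = f t * cis (2 * pi * t * s)" for t
    have h: "tame h" unfolding h_def by (rule tame_mult[OF f, where K = 1]) auto
    \<comment> \<open>the samples of \<open>FT f\<close> on \<open>s + \<int>/L\<close> are Fourier coefficients of the modulated function\<close>
    have "(\<integral>\<^sup>+n. ennreal ((cmod (FT h (of_int n / L)))\<^sup>2) \<partial>count_space UNIV) = ennreal L * (\<integral>\<^sup>+t. ennreal ((cmod (h t))\<^sup>2) \<partial>lborel)"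
      by (rule parseval[OF L h, of "-R"]) (use supp in \<open>simp add: h_def\<close>)
    moreover have "FT h (n / L) = FT f (s + n * (1/L))" for n
      unfolding FT_def h_def by (intro Bochner_Integration.integral_cong) (auto simp: cis_mult algebra_simps)
    ultimately show "(\<integral>\<^sup>+n. ennreal ((cmod (FT f (s + of_int n * (1/L))))\<^sup>2) \<partial>count_space UNIV) = ennreal L * (\<integral>\<^sup>+t. ennreal ((cmod (f t))\<^sup>2) \<partial>lborel)"
      by (simp add: h_def norm_mult)
  qed
  also have "\<dots> = ennreal (1/L) * ennreal L * (\<integral>\<^sup>+t. ennreal ((cmod (f t))\<^sup>2) \<partial>lborel)"
    using L by (subst nn_integral_multc) (auto simp: mult_ac)
  also have "ennreal (1/L) * ennreal L = 1" using L by (simp flip: ennreal_mult)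
  finally show ?thesis by simp
qed

lemma L2_iff: "f \<in> L2 \<longleftrightarrow> f \<in> borel_measurable borel \<and> (\<integral>\<^sup>+t. ennreal ((cmod (f t))\<^sup>2) \<partial>lborel) < \<infinity>"
  unfolding L2_def by (auto simp: integrable_iff_bounded)

lemma nn_l2_norm_sq: "f \<in> L2 \<Longrightarrow> (\<integral>\<^sup>+t. ennreal ((cmod (f t))\<^sup>2) \<partial>lborel) = ennreal (l2_norm_sq f)"
  unfolding L2_def l2_norm_sq_def by (intro nn_integral_eq_integral) auto

lemma l2_norm_sq_nonneg [simp]: "l2_norm_sq f \<ge> 0"
  unfolding l2_norm_sq_def by simp

lemma tame_L2: "tame f \<Longrightarrow> f \<in> L2"
  using tame_square_integrable by (auto simp: L2_def tame_def)

lemma FT_L2: "tame f \<Longrightarrow> FT f \<in> L2"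
  using tame_L2[of f] by (auto simp: L2_iff plancherel)

lemma FT_l2_norm_sq: "tame f \<Longrightarrow> l2_norm_sq (FT f) = l2_norm_sq f"
  using plancherel[of f] nn_l2_norm_sq[OF tame_L2, of f] nn_l2_norm_sq[OF FT_L2, of f] by simp

lemma L2_integrable_inner:
  assumes "f \<in> L2" "g \<in> L2"
  shows "integrable lborel (\<lambda>t. f t * cnj (g t))"
proof (rule Bochner_Integration.integrable_bound)
  show "integrable lborel (\<lambda>t. (cmod (f t))\<^sup>2 + (cmod (g t))\<^sup>2)" using assms by (auto simp: L2_def)
  show "(\<lambda>t. f t * cnj (g t)) \<in> borel_measurable lborel" using assms by (auto simp: L2_def)
  show "AE x in lborel. norm (f x * cnj (g x)) \<le> norm ((cmod (f x))\<^sup>2 + (cmod (g x))\<^sup>2)"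
  proof (intro AE_I2)
    fix x
    have "2 * (cmod (f x) * cmod (g x)) \<le> (cmod (f x))\<^sup>2 + (cmod (g x))\<^sup>2"
      using sum_squares_bound[of "cmod (f x)" "cmod (g x)"] by simp
    moreover have "0 \<le> cmod (f x) * cmod (g x)" by simp
    ultimately have "cmod (f x) * cmod (g x) \<le> (cmod (f x))\<^sup>2 + (cmod (g x))\<^sup>2" by linarith
    then show "norm (f x * cnj (g x)) \<le> norm ((cmod (f x))\<^sup>2 + (cmod (g x))\<^sup>2)" by (simp add: norm_mult)
  qed
qed

lemma l2_norm_sq_add_scaled:
  assumes "f \<in> L2" "g \<in> L2"
  shows "l2_norm_sq (\<lambda>t. f t + c * g t) = l2_norm_sq f + (cmod c)\<^sup>2 * l2_norm_sq g + 2 * Re (cnj c * l2_inner f g)"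
proof -
  have "(cmod (f t + c * g t))\<^sup>2 = (cmod (f t))\<^sup>2 + (cmod c)\<^sup>2 * (cmod (g t))\<^sup>2 + 2 * Re (cnj c * (f t * cnj (g t)))" for t
    by (simp add: cmod_power2) (simp add: power2_eq_square algebra_simps)
  moreover have "integrable lborel (\<lambda>t. cnj c * (f t * cnj (g t)))"
    using L2_integrable_inner[OF assms] by simp
  ultimately show ?thesis
    using assms unfolding l2_norm_sq_def l2_inner_def L2_def by (simp del: times_complex.sel)
qed

text \<open>Polarization: norms of \<open>f + c g\<close> are preserved for every \<open>c\<close>;
  c = 1 recovers the real part and c = \<i> the imaginary part of the inner product.\<close>

lemma FT_l2_inner:
  assumes f: "tame f" and g: "tame g"
  shows "l2_inner (FT f) (FT g) = l2_inner f g"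
proof -
  have "Re (cnj c * l2_inner (FT f) (FT g)) = Re (cnj c * l2_inner f g)" for c
  proof -
    have "FT (\<lambda>t. f t + c * g t) = (\<lambda>s. FT f s + c * FT g s)"
      using f g by (intro ext) (simp add: FT_add tame_cmult FT_cmult)
    then have "l2_norm_sq (\<lambda>s. FT f s + c * FT g s) = l2_norm_sq (\<lambda>t. f t + c * g t)"
      using FT_l2_norm_sq[OF tame_add[OF f tame_cmult[OF g, of c]]] by simp
    then show ?thesis
      using f g by (simp add: l2_norm_sq_add_scaled tame_L2 FT_L2 FT_l2_norm_sq)
  qed
  from this[of 1] this[of \<i>] show ?thesis by (simp add: complex_eq_iff)
qed

text \<open>Fubini on the absolutely integrable double integral; conjugating the kernel reverses the
  frequency. It moves a Gabor coefficient to the Fourier side, where the atom has bounded support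
  although \<open>FT f\<close> in general does not.\<close>

lemma FT_multiplication_formula:
  assumes f: "tame f" and g: "tame g"
  shows "l2_inner f (FT g) = l2_inner (\<lambda>s. FT f (- s)) g"
proof -
  have [measurable]: "f \<in> borel_measurable borel" "g \<in> borel_measurable borel" using f g by (simp_all add: tame_def)
  have "integrable (lborel \<Otimes>\<^sub>M lborel) (\<lambda>(t, s). f t * cnj (g s * cis (2 * pi * s * t)))"
  proof (rule Bochner_Integration.integrable_bound)
    have "integrable (lborel \<Otimes>\<^sub>M lborel) (\<lambda>(t, s). f t * g s)"
    proof (rule lborel_pair.Fubini_integrable)
      show "integrable lborel (\<lambda>x. LINT y|lborel. norm (case (x, y) of (t, s) \<Rightarrow> f t * g s))"
        using tame_integrable[OF f] by (simp add: norm_mult)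
      show "AE x in lborel. integrable lborel (\<lambda>y. case (x, y) of (t, s) \<Rightarrow> f t * g s)"
        using tame_integrable[OF g] by simp
    qed auto
    then show "integrable (lborel \<Otimes>\<^sub>M lborel) (\<lambda>x. f (fst x) * g (snd x))" by (simp add: split_beta')
  qed (auto simp: split_beta' norm_mult)
  note F = lborel_pair.Fubini_integral[OF this]
  have "l2_inner f (FT g) = (LINT t|lborel. LINT s|lborel. f t * cnj (g s * cis (2 * pi * s * t)))"
    unfolding l2_inner_def FT_def Bochner_Integration.integral_cnj[symmetric] by simp
  also have "\<dots> = (LINT s|lborel. LINT t|lborel. f t * cnj (g s * cis (2 * pi * s * t)))"
    using F by simp
  also have "\<dots> = (LINT s|lborel. LINT t|lborel. cnj (g s) * (f t * cis (2 * pi * t * (- s))))"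
    by (intro Bochner_Integration.integral_cong refl) (simp add: cis_cnj mult_ac)
  also have "\<dots> = l2_inner (\<lambda>s. FT f (- s)) g"
    unfolding l2_inner_def FT_def by (simp add: mult.commute)
  finally show ?thesis .
qed

lemma tame_periodization_bound:
  assumes h: "tame h" and p: "p > 0"
  obtains K :: int where "\<And>x k. x \<in> {0..<p} \<Longrightarrow> h (x + of_int k * p) \<noteq> 0 \<Longrightarrow> k \<in> {-K..K}"
proof -
  obtain R where R: "\<And>t. h t \<noteq> 0 \<Longrightarrow> \<bar>t\<bar> \<le> R" using h by (auto simp: tame_def)
  have "k \<in> {-\<lceil>R / p + 1\<rceil>..\<lceil>R / p + 1\<rceil>}" if x: "x \<in> {0..<p}" "h (x + of_int k * p) \<noteq> 0" for x k
  proof -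
    have "\<bar>of_int k * p\<bar> \<le> R + p" using R[OF x(2)] x(1) by (auto simp: abs_le_iff)
    then have "\<bar>real_of_int k\<bar> * p \<le> (R / p + 1) * p" using p by (simp add: abs_mult distrib_right)
    then have "\<bar>real_of_int k\<bar> \<le> R / p + 1" using p by simp
    then have "\<bar>k\<bar> \<le> \<lceil>R / p + 1\<rceil>" by linarith
    then show ?thesis by (auto simp: abs_le_iff)
  qed
  then show ?thesis using that by blast
qed

text \<open>Only finitely many \<int>-translates meet one period, uniformly in the point, so the
  infinite sum is a finite one. Cutting \<open>h\<close> into tiles and moving each back to the
  first period multiplies its transform by a phase, which equals 1 at the frequencies
  \<open>n / p\<close>.\<close>

lemma tame_periodization:
  assumes h: "tame h" and p: "p > 0"
  shows "tame (\<lambda>x. indicator {0..<p} x * (\<Sum>\<^sub>\<infinity>k. h (x + of_int k * p)))"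
    and "FT (\<lambda>x. indicator {0..<p} x * (\<Sum>\<^sub>\<infinity>k. h (x + of_int k * p))) (of_int n / p) = FT h (of_int n / p)"
proof -
  obtain K where K: "\<And>x k. x \<in> {0..<p} \<Longrightarrow> h (x + of_int k * p) \<noteq> 0 \<Longrightarrow> k \<in> {-K..K}"
    using tame_periodization_bound[OF assms] by blast
  have eq: "(\<lambda>x. indicator {0..<p} x * (\<Sum>\<^sub>\<infinity>k. h (x + of_int k * p))) = (\<lambda>x. \<Sum>k\<in>{-K..K}. indicator {0..<p} x * h (x + of_int k * p))"
  proof
    fix x
    show "indicator {0..<p} x * (\<Sum>\<^sub>\<infinity>k. h (x + of_int k * p)) = (\<Sum>k\<in>{-K..K}. indicator {0..<p} x * h (x + of_int k * p))"
    proof (cases "x \<in> {0..<p}")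
      case True
      have "(\<Sum>\<^sub>\<infinity>k. h (x + of_int k * p)) = (\<Sum>\<^sub>\<infinity>k\<in>{-K..K}. h (x + of_int k * p))"
        using K[OF True] by (intro infsum_cong_neutral) auto
      then show ?thesis using True by simp
    qed auto
  qed
  have t: "tame (\<lambda>x. indicator {0..<p} x * h (x + of_int k * p))" for k
    by (intro tame_prod tame_indicator tame_shift h)
  show "tame (\<lambda>x. indicator {0..<p} x * (\<Sum>\<^sub>\<infinity>k. h (x + of_int k * p)))"
    unfolding eq by (intro tame_sum t) auto
  have t': "tame (\<lambda>x. indicator {of_int k * p..<(of_int k + 1) * p} x * h x)" for k :: int
    by (intro tame_prod tame_indicator h)
  have FTsum: "finite A \<Longrightarrow> (\<And>k. tame (f k)) \<Longrightarrow> FT (\<lambda>x. \<Sum>k\<in>A. f k x) s = (\<Sum>k\<in>A. FT (f k) s)" for f s and A :: "int set"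
  proof (induction A rule: finite_induct)
    case empty
    then show ?case by (simp add: FT_def)
  qed (simp add: FT_add tame_sum)
  have hsum: "h = (\<lambda>x. \<Sum>k\<in>{-K..K}. indicator {of_int k * p..<(of_int k + 1) * p} x * h x)"
  proof
    fix x
    define k0 where "k0 = \<lfloor>x / p\<rfloor>"
    have ind: "indicator {of_int k * p..<(of_int k + 1) * p} x = (if k = k0 then 1 else 0 :: complex)" for k :: int
      using tile_index[OF p, of x k] by (simp add: indicator_def k0_def)
    have "x - of_int k0 * p \<in> {0..<p}"
      using ind[of k0] by (auto simp: indicator_def algebra_simps split: if_splits)
    from K[OF this, of k0] have "h x \<noteq> 0 \<Longrightarrow> k0 \<in> {-K..K}" by simp
    then show "h x = (\<Sum>k\<in>{-K..K}. indicator {of_int k * p..<(of_int k + 1) * p} x * h x)"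
      unfolding ind by (cases "h x = 0") (auto simp: if_distrib[of "\<lambda>y. y * h x"] cong: if_cong)
  qed
  have "FT (\<lambda>x. indicator {0..<p} x * h (x + of_int k * p)) (of_int n / p) = FT (\<lambda>x. indicator {of_int k * p..<(of_int k + 1) * p} x * h x) (of_int n / p)" for k :: int
  proof -
    have "(\<lambda>x. indicator {0..<p} x * h (x + of_int k * p)) = (\<lambda>x. (\<lambda>y. indicator {of_int k * p..<(of_int k + 1) * p} y * h y) (x + of_int k * p))"
      by (auto simp: indicator_def algebra_simps)
    then have "FT (\<lambda>x. indicator {0..<p} x * h (x + of_int k * p)) (of_int n / p) =
       cis (- 2 * pi * (of_int k * p) * (of_int n / p)) * FT (\<lambda>x. indicator {of_int k * p..<(of_int k + 1) * p} x * h x) (of_int n / p)"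
      by (simp only: FT_shift[of "\<lambda>y. indicator {of_int k * p..<(of_int k + 1) * p} y * h y"])
    also have "- 2 * pi * (of_int k * p) * (of_int n / p) = 2 * pi * of_int (- k * n)" using p by simp
    finally show ?thesis by (simp add: cis_multiple_2pi del: of_int_mult of_int_minus)
  qed
  then show "FT (\<lambda>x. indicator {0..<p} x * (\<Sum>\<^sub>\<infinity>k. h (x + of_int k * p))) (of_int n / p) = FT h (of_int n / p)"
    unfolding eq by (subst (2) hsum) (simp only: FTsum[OF _ t] FTsum[OF _ t'] finite_atLeastAtMost_int)
qed

text \<open>Parseval for the periodization of \<open>h\<close>. With \<open>p = 1/\<alpha>\<close>
  the samples are taken at multiples of \<alpha>, so this evaluates the sum over all time shifts for
  a fixed frequency shift.\<close>

lemma poisson_parseval: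
  assumes h: "tame h" and p: "p > 0"
  shows "(\<integral>\<^sup>+n. ennreal ((cmod (FT h (of_int n / p)))\<^sup>2) \<partial>count_space UNIV) =
    ennreal p * (\<integral>\<^sup>+x. indicator {0..<p} x * ennreal ((cmod (\<Sum>\<^sub>\<infinity>k. h (x + of_int k * p)))\<^sup>2) \<partial>lborel)"
proof -
  note P = tame_periodization[OF h p]
  have "(\<integral>\<^sup>+n. ennreal ((cmod (FT h (of_int n / p)))\<^sup>2) \<partial>count_space UNIV) =
    ennreal p * (\<integral>\<^sup>+x. ennreal ((cmod (indicator {0..<p} x * (\<Sum>\<^sub>\<infinity>k. h (x + of_int k * p))))\<^sup>2) \<partial>lborel)"
    unfolding P(2)[symmetric] by (rule parseval[OF p P(1), of 0]) auto
  also have "(\<lambda>x. ennreal ((cmod (indicator {0..<p} x * (\<Sum>\<^sub>\<infinity>k. h (x + of_int k * p))))\<^sup>2)) =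
     (\<lambda>x. indicator {0..<p} x * ennreal ((cmod (\<Sum>\<^sub>\<infinity>k. h (x + of_int k * p)))\<^sup>2))"
    by (auto simp: indicator_def)
  finally show ?thesis .
qed

subsection \<open>Estimates for the Gabor matrix\<close>

text \<open>The Fourier-side profile of g (see \<open>FT_exp_window\<close>). The half-open support
  keeps membership unchanged under small moves to the right, which the density argument exploits,
  and makes ceilings count lattice points exactly.\<close>

definition exp_window :: "real \<Rightarrow> real \<Rightarrow> real \<Rightarrow> complex" where
  "exp_window b w \<xi> = indicator {-b/2..<b/2} \<xi> * of_real (exp (2 * pi * w * \<xi>))"

lemma cmod_exp_window_le:
  assumes "w < 0"
  shows "cmod (exp_window b w \<xi>) \<le> exp (- pi * w * b)"
proof (cases "\<xi> \<in> {-b/2..<b/2}")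
  case True
  then have "(- (2 * pi * w)) * (- \<xi>) \<le> (- (2 * pi * w)) * (b / 2)"
    using assms by (intro mult_left_mono) (auto simp: mult_nonneg_nonpos)
  then have "2 * pi * w * \<xi> \<le> - pi * w * b" by simp
  then show ?thesis using True by (simp add: exp_window_def norm_mult)
qed (auto simp: exp_window_def)

lemma tame_exp_window:
  assumes "w < 0" shows "tame (exp_window b w)"
proof -
  have "tame (\<lambda>\<xi>. indicator {-b/2..<b/2} \<xi> * of_real (exp (2 * pi * w * \<xi>)))"
  proof (rule tame_mult[OF tame_indicator, where K = "exp (- pi * w * b)"])
    fix \<xi> assume "indicator {-b/2..<b/2} \<xi> \<noteq> (0::complex)"
    then show "cmod (of_real (exp (2 * pi * w * \<xi>))) \<le> exp (- pi * w * b)"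
      using cmod_exp_window_le[OF assms, of b \<xi>] by (auto simp: exp_window_def indicator_def split: if_splits)
  qed measurable
  then show ?thesis by (simp add: exp_window_def[abs_def])
qed

text \<open>Strong induction on the truncation level \<open>N\<close>: the recursion advances the
  index by a jump \<open>j\<close> and pays exactly the weight \<open>r ^ j\<close>. The terms
  jumped over are nonnegative and can be added for free, so the unknown jump lengths disappear from
  the bound.\<close>

lemma geometric_recursion_partial:
  fixes e z :: "int \<Rightarrow> real"
  assumes r: "0 \<le> r" "r \<le> 1" and z: "\<And>k. z k \<ge> 0" and B: "\<And>k. e k \<le> B" "B \<ge> 0"
    and rec: "\<And>k. \<exists>j\<ge>1. e k \<le> z k + r ^ j * e (k + int j)"
  shows "e k \<le> (\<Sum>i<N. r ^ i * z (k + int i)) + r ^ N * B"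
proof (induction N arbitrary: k rule: less_induct)
  case (less N)
  show ?case
  proof (cases "N = 0")
    case True
    then show ?thesis using B by simp
  next
    case False
    obtain j where j: "j \<ge> 1" "e k \<le> z k + r ^ j * e (k + int j)" using rec[of k] by blast
    show ?thesis
    proof (cases "j \<ge> N")
      case True
      \<comment> \<open>The jump already passes level \<open>N\<close>, so the crude bound
        \<open>B\<close> is enough for the remainder.\<close>
      have "r ^ j * e (k + int j) \<le> r ^ j * B" using r B by (intro mult_left_mono) auto
      also have "\<dots> \<le> r ^ N * B" using r B True by (intro mult_right_mono power_decreasing) auto
      finally have "e k \<le> z k + r ^ N * B" using j by simp
      also have "z k = (\<Sum>i\<in>{0}. r ^ i * z (k + int i))" by simp
      also have "\<dots> \<le> (\<Sum>i<N. r ^ i * z (k + int i))"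
        using r z False by (intro sum_mono2) auto
      finally show ?thesis by simp
    next
      case jN: False
      have "e (k + int j) \<le> (\<Sum>i<N - j. r ^ i * z (k + int j + int i)) + r ^ (N - j) * B"
        using less.IH[of "N - j" "k + int j"] j False by simp
      then have "r ^ j * e (k + int j) \<le> r ^ j * ((\<Sum>i<N - j. r ^ i * z (k + int j + int i)) + r ^ (N - j) * B)"
        using r by (intro mult_left_mono) auto
      also have "\<dots> = (\<Sum>i<N - j. r ^ (j + i) * z (k + int (j + i))) + r ^ N * B"
        using jN power_add[of r j "N - j"] by (simp add: distrib_left sum_distrib_left power_add mult_ac add_ac)
      also have "(\<Sum>i<N - j. r ^ (j + i) * z (k + int (j + i))) = (\<Sum>i\<in>{j..<N}. r ^ i * z (k + int i))"
        using jN by (intro sum.reindex_bij_witness[of _ "\<lambda>i. i - j" "\<lambda>i. j + i"]) auto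
      finally have "e k \<le> (\<Sum>i\<in>insert 0 {j..<N}. r ^ i * z (k + int i)) + r ^ N * B"
        using j by simp
      also have "(\<Sum>i\<in>insert 0 {j..<N}. r ^ i * z (k + int i)) \<le> (\<Sum>i<N. r ^ i * z (k + int i))"
        using r z False by (intro sum_mono2) auto
      finally show ?thesis by simp
    qed
  qed
qed

text \<open>Boundedness of \<open>e\<close> makes the remainder \<open>r ^ N * B\<close> vanish in
  the limit. Summing over \<open>k\<close>, every shift of \<open>z\<close> contributes the same
  total, and the weights form a geometric series.\<close>

lemma geometric_recursion_sum:
  fixes e z :: "int \<Rightarrow> real"
  assumes r: "0 \<le> r" "r < 1" and z: "\<And>k. z k \<ge> 0" and e: "\<And>k. e k \<ge> 0" and B: "\<And>k. e k \<le> B"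
    and rec: "\<And>k. \<exists>j\<ge>1. e k \<le> z k + r ^ j * e (k + int j)"
  shows "(\<integral>\<^sup>+k. ennreal (e k) \<partial>count_space UNIV) \<le> ennreal (1 / (1 - r)) * (\<integral>\<^sup>+k. ennreal (z k) \<partial>count_space UNIV)"
proof -
  have B0: "B \<ge> 0" using e[of 0] B[of 0] by linarith
  have pw: "ennreal (e k) \<le> (\<Sum>i. ennreal (r ^ i) * ennreal (z (k + int i)))" (is "_ \<le> ?S") for k
  proof (rule LIMSEQ_le_const)
    have "(\<lambda>N. r ^ N * B) \<longlonglongrightarrow> 0 * B" using r by (intro tendsto_intros LIMSEQ_realpow_zero) auto
    then have "(\<lambda>N. ennreal (r ^ N * B)) \<longlonglongrightarrow> ennreal 0" by (intro tendsto_ennrealI) simp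
    then show "(\<lambda>N. ?S + ennreal (r ^ N * B)) \<longlonglongrightarrow> ?S"
      using tendsto_add[OF tendsto_const, of _ "ennreal 0" _ ?S] by simp
    have "ennreal (e k) \<le> ?S + ennreal (r ^ N * B)" for N
    proof -
      have "ennreal (e k) \<le> ennreal ((\<Sum>i<N. r ^ i * z (k + int i)) + r ^ N * B)"
        using geometric_recursion_partial[of r z e B k N] r z B B0 rec by (intro ennreal_leI) auto
      also have "\<dots> = (\<Sum>i<N. ennreal (r ^ i) * ennreal (z (k + int i))) + ennreal (r ^ N * B)"
        using r z B0 by (subst ennreal_plus) (auto intro!: sum_nonneg simp: ennreal_mult simp flip: sum_ennreal)
      also have "(\<Sum>i<N. ennreal (r ^ i) * ennreal (z (k + int i))) \<le> ?S"
        by (rule sum_le_suminf) auto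
      finally show ?thesis by (simp add: add_right_mono)
    qed
    then show "\<exists>N. \<forall>n\<ge>N. ennreal (e k) \<le> ?S + ennreal (r ^ n * B)" by blast
  qed
  have "(\<integral>\<^sup>+k. ennreal (e k) \<partial>count_space UNIV) \<le> (\<integral>\<^sup>+k. (\<Sum>i. ennreal (r ^ i) * ennreal (z (k + int i))) \<partial>count_space UNIV)"
    by (intro nn_integral_mono pw)
  also have "\<dots> = (\<Sum>i. \<integral>\<^sup>+k. ennreal (r ^ i) * ennreal (z (k + int i)) \<partial>count_space UNIV)"
    by (intro nn_integral_suminf) auto
  also have "\<dots> = (\<Sum>i. ennreal (r ^ i) * (\<integral>\<^sup>+k. ennreal (z k) \<partial>count_space UNIV))"
    using nn_sum_shift[of "\<lambda>k. ennreal (z k)"] by (simp add: nn_integral_cmult)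
  also have "\<dots> = (\<Sum>i. ennreal (r ^ i)) * (\<integral>\<^sup>+k. ennreal (z k) \<partial>count_space UNIV)"
    by simp
  also have "(\<Sum>i. ennreal (r ^ i)) = ennreal (1 / (1 - r))"
    using r by (subst suminf_ennreal2) (auto simp: suminf_geometric summable_geometric)
  finally show ?thesis .
qed

lemma card_int_progression:
  fixes p q u l :: real
  assumes p: "p > 0" and l: "l \<ge> 0"
  shows "finite {k::int. u \<le> q + of_int k * p \<and> q + of_int k * p < u + l}"
    and "real (card {k::int. u \<le> q + of_int k * p \<and> q + of_int k * p < u + l}) \<le> l / p + 1"
proof -
  have eq: "{k::int. u \<le> q + of_int k * p \<and> q + of_int k * p < u + l} = {\<lceil>(u - q) / p\<rceil>..<\<lceil>(u + l - q) / p\<rceil>}"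
  proof -
    have "u \<le> q + of_int k * p \<longleftrightarrow> \<lceil>(u - q) / p\<rceil> \<le> k" for k
      using p by (simp add: ceiling_le_iff pos_divide_le_eq algebra_simps)
    moreover have "q + of_int k * p < u + l \<longleftrightarrow> k < \<lceil>(u + l - q) / p\<rceil>" for k
      using p by (simp add: less_ceiling_iff pos_less_divide_eq algebra_simps)
    ultimately show ?thesis by auto
  qed
  show "finite {k::int. u \<le> q + of_int k * p \<and> q + of_int k * p < u + l}" unfolding eq by simp
  have "(u - q) / p \<le> (u + l - q) / p" using p l by (intro divide_right_mono) auto
  then have "\<lceil>(u - q) / p\<rceil> \<le> \<lceil>(u + l - q) / p\<rceil>" by (rule ceiling_mono)
  moreover have "(u + l - q) / p - (u - q) / p = l / p" by (simp add: diff_divide_distrib add_divide_distrib)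
  ultimately show "real (card {k::int. u \<le> q + of_int k * p \<and> q + of_int k * p < u + l}) \<le> l / p + 1"
    unfolding eq by (simp add: of_nat_diff) linarith
qed

lemma exp_window_nonzero_iff: "exp_window b w \<xi> \<noteq> 0 \<longleftrightarrow> -b/2 \<le> \<xi> \<and> \<xi> < b/2"
  by (auto simp: exp_window_def indicator_def)

text \<open>Schur-type estimate: a row has at most b/p + 1 nonzero entries, a column at most
  b/\<beta> + 1, and every entry is bounded. Cauchy-Schwarz in each row followed by interchanging
  the two sums gives the product of these bounds.\<close>

lemma gabor_matrix_upper:
  fixes c :: "int \<Rightarrow> complex"
  assumes b: "b > 0" and w: "w < 0" and p: "p > 0" and \<beta>: "\<beta> > 0"
  shows "(\<integral>\<^sup>+m. ennreal ((cmod (\<Sum>\<^sub>\<infinity>k. exp_window b w (x + of_int k * p - \<beta> * of_int m) * c k))\<^sup>2) \<partial>count_space UNIV)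
    \<le> ennreal ((b / p + 1) * (exp (- pi * w * b))\<^sup>2 * (b / \<beta> + 1)) * (\<integral>\<^sup>+k. ennreal ((cmod (c k))\<^sup>2) \<partial>count_space UNIV)"
proof -
  define G where "G = exp (- pi * w * b)"
  \<comment> \<open>\<open>S m\<close> is the support of row \<open>m\<close> of the matrix, and
    \<open>T k\<close> that of column \<open>k\<close>.\<close>
  define S where "S m = {k::int. -b/2 \<le> (x - \<beta> * of_int m) + of_int k * p \<and> (x - \<beta> * of_int m) + of_int k * p < -b/2 + b}" for m :: int
  define T where "T k = {m::int. m \<in> {m. k \<in> S m}}" for k
  have S: "finite (S m)" "real (card (S m)) \<le> b / p + 1" for m
    unfolding S_def using card_int_progression[OF p, of b "-b/2" "x - \<beta> * of_int m"] b by auto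
  have T: "finite (T k)" "real (card (T k)) \<le> b / \<beta> + 1" for k
  proof -
    have "T k = uminus ` {m::int. -b/2 \<le> (x + of_int k * p) + of_int m * \<beta> \<and> (x + of_int k * p) + of_int m * \<beta> < -b/2 + b}"
    proof (intro set_eqI iffI)
      fix m assume "m \<in> T k"
      then show "m \<in> uminus ` {m::int. -b/2 \<le> (x + of_int k * p) + of_int m * \<beta> \<and> (x + of_int k * p) + of_int m * \<beta> < -b/2 + b}"
        by (intro image_eqI[of _ _ "- m"]) (auto simp: T_def S_def algebra_simps)
    qed (auto simp: T_def S_def algebra_simps)
    then show "finite (T k)" "real (card (T k)) \<le> b / \<beta> + 1"
      using card_int_progression[OF \<beta>, of b "-b/2" "x + of_int k * p"] b
      by (auto simp: card_image inj_on_def)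
  qed
  have nz: "k \<in> S m \<longleftrightarrow> exp_window b w (x + of_int k * p - \<beta> * of_int m) \<noteq> 0" for k m
    unfolding exp_window_nonzero_iff S_def by (auto simp: algebra_simps)
  have bound: "(cmod (\<Sum>\<^sub>\<infinity>k. exp_window b w (x + of_int k * p - \<beta> * of_int m) * c k))\<^sup>2 \<le> (b / p + 1) * G\<^sup>2 * (\<Sum>k\<in>S m. (cmod (c k))\<^sup>2)" for m
  proof -
    have "(\<Sum>\<^sub>\<infinity>k. exp_window b w (x + of_int k * p - \<beta> * of_int m) * c k) = (\<Sum>\<^sub>\<infinity>k\<in>S m. exp_window b w (x + of_int k * p - \<beta> * of_int m) * c k)"
      using nz by (intro infsum_cong_neutral) auto
    also have "\<dots> = (\<Sum>k\<in>S m. exp_window b w (x + of_int k * p - \<beta> * of_int m) * c k)"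
      using S by simp
    finally have "(cmod (\<Sum>\<^sub>\<infinity>k. exp_window b w (x + of_int k * p - \<beta> * of_int m) * c k))\<^sup>2 \<le> (\<Sum>k\<in>S m. cmod (exp_window b w (x + of_int k * p - \<beta> * of_int m) * c k))\<^sup>2"
      by (simp add: power_mono norm_sum)
    also have "\<dots> \<le> (\<Sum>k\<in>S m. G * cmod (c k))\<^sup>2"
      unfolding G_def norm_mult
      by (intro power_mono sum_mono mult_right_mono cmod_exp_window_le w sum_nonneg) auto
    also have "\<dots> \<le> real (card (S m)) * (\<Sum>k\<in>S m. (G * cmod (c k))\<^sup>2)"
      using sum_squared_le_sum_of_squares[of "\<lambda>k. G * cmod (c k)" "S m"] by (simp add: mult.commute)
    also have "\<dots> \<le> (b / p + 1) * (\<Sum>k\<in>S m. (G * cmod (c k))\<^sup>2)"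
      by (intro mult_right_mono S sum_nonneg) auto
    also have "\<dots> = (b / p + 1) * G\<^sup>2 * (\<Sum>k\<in>S m. (cmod (c k))\<^sup>2)"
      by (simp add: power_mult_distrib sum_distrib_left mult.assoc)
    finally show ?thesis .
  qed
  have K0: "(b / p + 1) * G\<^sup>2 \<ge> 0" using b p by auto
  have "(\<integral>\<^sup>+m. ennreal ((cmod (\<Sum>\<^sub>\<infinity>k. exp_window b w (x + of_int k * p - \<beta> * of_int m) * c k))\<^sup>2) \<partial>count_space UNIV)
    \<le> (\<integral>\<^sup>+m. ennreal ((b / p + 1) * G\<^sup>2) * (\<integral>\<^sup>+k. ennreal ((cmod (c k))\<^sup>2) * indicator (T k) m \<partial>count_space UNIV) \<partial>count_space UNIV)"
  proof (rule nn_integral_mono)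
    fix m :: int
    have "ennreal (\<Sum>k\<in>S m. (cmod (c k))\<^sup>2) = (\<integral>\<^sup>+k. ennreal ((cmod (c k))\<^sup>2) \<partial>count_space (S m))"
      using S by (simp add: nn_integral_count_space_finite)
    also have "\<dots> = (\<integral>\<^sup>+k. ennreal ((cmod (c k))\<^sup>2) * indicator (T k) m \<partial>count_space UNIV)"
      by (auto simp: nn_integral_count_space_indicator T_def indicator_def intro!: nn_integral_cong)
    finally have *: "ennreal (\<Sum>k\<in>S m. (cmod (c k))\<^sup>2) = \<dots>" .
    show "ennreal ((cmod (\<Sum>\<^sub>\<infinity>k. exp_window b w (x + of_int k * p - \<beta> * of_int m) * c k))\<^sup>2) \<le> ennreal ((b / p + 1) * G\<^sup>2) * (\<integral>\<^sup>+k. ennreal ((cmod (c k))\<^sup>2) * indicator (T k) m \<partial>count_space UNIV)"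
      unfolding *[symmetric] using bound[of m] K0 by (subst ennreal_mult[symmetric]) (auto intro!: ennreal_leI sum_nonneg)
  qed
  also have "\<dots> = ennreal ((b / p + 1) * G\<^sup>2) * (\<integral>\<^sup>+k. (\<integral>\<^sup>+m. ennreal ((cmod (c k))\<^sup>2) * indicator (T k) m \<partial>count_space UNIV) \<partial>count_space UNIV)"
    using nn_sum_swap[of "\<lambda>k m. ennreal ((cmod (c k))\<^sup>2) * indicator (T k) m" "count_space UNIV"]
    by (subst nn_integral_cmult) simp_all
  also have "\<dots> = ennreal ((b / p + 1) * G\<^sup>2) * (\<integral>\<^sup>+k. ennreal ((cmod (c k))\<^sup>2) * ennreal (real (card (T k))) \<partial>count_space UNIV)"
    using T by (simp add: nn_integral_cmult_indicator ennreal_of_nat_eq_real_of_nat)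
  also have "\<dots> \<le> ennreal ((b / p + 1) * G\<^sup>2) * (\<integral>\<^sup>+k. ennreal ((cmod (c k))\<^sup>2) * ennreal (b / \<beta> + 1) \<partial>count_space UNIV)"
    by (intro mult_left_mono nn_integral_mono ennreal_leI T) auto
  also have "\<dots> = ennreal ((b / p + 1) * G\<^sup>2) * ennreal (b / \<beta> + 1) * (\<integral>\<^sup>+k. ennreal ((cmod (c k))\<^sup>2) \<partial>count_space UNIV)"
    by (subst nn_integral_multc) (auto simp: mult_ac)
  also have "ennreal ((b / p + 1) * G\<^sup>2) * ennreal (b / \<beta> + 1) = ennreal ((b / p + 1) * G\<^sup>2 * (b / \<beta> + 1))"
    using K0 b \<beta> by (subst ennreal_mult) auto
  finally show ?thesis unfolding G_def .
qed

text \<open>In the constant, \<open>exp (- 2 * pi * w * b)\<close> is the squared bound for the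
  reciprocal of the window, one factor 1/(1 - r) comes from splitting a square and one from the
  geometric recursion, and 4 comes from recovering \<open>c\<close> from two neighbouring tails.
  Boundedness of \<open>c\<close> guarantees that the tails exist and are bounded.\<close>

lemma gabor_matrix_lower:
  fixes c :: "int \<Rightarrow> complex"
  assumes b: "b > 0" and w: "w < 0" and p: "p > 0" and \<beta>: "\<beta> > 0" "\<beta> \<le> b" "\<beta> \<le> p"
    and bdd: "\<And>k. cmod (c k) \<le> C"
  defines "r \<equiv> exp (2 * pi * w * p)"
  shows "(\<integral>\<^sup>+k. ennreal ((cmod (c k))\<^sup>2) \<partial>count_space UNIV) \<le>
    ennreal (4 * exp (- 2 * pi * w * b) / (1 - r)\<^sup>2) *
    (\<integral>\<^sup>+m. ennreal ((cmod (\<Sum>\<^sub>\<infinity>k. exp_window b w (x + of_int k * p - \<beta> * of_int m) * c k))\<^sup>2) \<partial>count_space UNIV)"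
proof -
  define y where "y m = (\<Sum>\<^sub>\<infinity>k. exp_window b w (x + of_int k * p - \<beta> * of_int m) * c k)" for m :: int
  have r: "0 < r" "r < 1" using w p by (auto simp: r_def mult_neg_pos mult_pos_neg)
  have C0: "C \<ge> 0" using bdd[of 0] norm_ge_zero order_trans by blast
  have sm: "summable (\<lambda>i. cmod (of_real (r ^ i) * c (k + int i)))" for k
  proof (rule summable_comparison_test')
    show "summable (\<lambda>i. r ^ i * C)" using r by (intro summable_mult2 summable_geometric) auto
    show "norm (cmod (of_real (r ^ i) * c (k + int i))) \<le> r ^ i * C" for i
      using r bdd by (simp add: norm_mult norm_power mult_left_mono)
  qed
  \<comment> \<open>A finite stretch of the progression weighted by powers of \<open>r\<close> is a
    difference of two tails, so each row involves only two of the new unknowns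
    \<open>E\<close>.\<close>
  define E where "E k = (\<Sum>i. of_real (r ^ i) * c (k + int i))" for k
  have Ebd: "cmod (E k) \<le> C / (1 - r)" for k
  proof -
    have "cmod (E k) \<le> (\<Sum>i. cmod (of_real (r ^ i) * c (k + int i)))"
      unfolding E_def by (rule summable_norm[OF sm])
    also have "\<dots> \<le> (\<Sum>i. r ^ i * C)"
      using r bdd sm by (intro suminf_le summable_mult2 summable_geometric) (auto simp: norm_mult norm_power mult_left_mono)
    also have "\<dots> = C / (1 - r)" using r by (subst suminf_mult2[symmetric]) (auto simp: suminf_geometric summable_geometric)
    finally show ?thesis .
  qed
  have Esplit: "E k = (\<Sum>i<j. of_real (r ^ i) * c (k + int i)) + of_real (r ^ j) * E (k + int j)" for k j
  proof -
    have s: "summable (\<lambda>i. of_real (r ^ i) * c (k + int i))" for k by (rule summable_norm_cancel[OF sm])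
    have "E k = (\<Sum>i. of_real (r ^ (i + j)) * c (k + int (i + j))) + (\<Sum>i<j. of_real (r ^ i) * c (k + int i))"
      unfolding E_def by (rule suminf_split_initial_segment[OF s])
    also have "(\<Sum>i. of_real (r ^ (i + j)) * c (k + int (i + j))) = (\<Sum>i. of_real (r ^ j) * (of_real (r ^ i) * c (k + int j + int i)))"
      by (intro suminf_cong) (simp add: power_add algebra_simps)
    also have "\<dots> = of_real (r ^ j) * E (k + int j)"
      unfolding E_def by (rule suminf_mult[OF s])
    finally show ?thesis by simp
  qed
  \<comment> \<open>The last window starting at or before \<open>x + of_int k * p\<close>; the
    window with index \<open>m\<close> starts at \<open>\<beta> * of_int m - b/2\<close>.\<close>
  define m where "m k = \<lfloor>(x + of_int k * p + b/2) / \<beta>\<rfloor>" for k :: int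
  have m1: "\<beta> * of_int (m k) \<le> x + of_int k * p + b/2" "x + of_int k * p + b/2 < \<beta> * of_int (m k) + \<beta>" for k
  proof -
    have "of_int (m k) \<le> (x + of_int k * p + b/2) / \<beta>" "(x + of_int k * p + b/2) / \<beta> < of_int (m k) + 1"
      unfolding m_def by linarith+
    then show "\<beta> * of_int (m k) \<le> x + of_int k * p + b/2" "x + of_int k * p + b/2 < \<beta> * of_int (m k) + \<beta>"
      using \<beta> by (simp_all add: field_simps)
  qed
  \<comment> \<open>Since \<beta> \<le> p, passing to the next lattice point admits at least one
    further window start.\<close>
  have inj: "inj m"
  proof (rule strict_mono_imp_inj_on, rule strict_monoI)
    fix k l :: int assume "k < l"
    then have "of_int k + 1 \<le> (of_int l :: real)" by linarith
    then have "(of_int k + 1) * p \<le> of_int l * p" using p by (intro mult_right_mono) auto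
    then have "x + of_int k * p + b / 2 + p \<le> x + of_int l * p + b/2" by (simp add: algebra_simps)
    then have "\<beta> * of_int (m k) + \<beta> < \<beta> * of_int (m l) + \<beta>" using m1(1)[of k] m1(2)[of l] \<beta> by linarith
    then show "m k < m l" using \<beta> by simp
  qed
  define M where "M = exp (- pi * w * b)"
  have step: "\<exists>j\<ge>1. cmod (E k) \<le> M * cmod (y (m k)) + r ^ j * cmod (E (k + int j))" for k
  proof -
    define u where "u = x + of_int k * p - \<beta> * of_int (m k)"
    \<comment> \<open>The ceiling is the first index at or beyond the right end of the window, so
      \<open>j\<close> counts the indices that the window sees from \<open>k\<close> on.\<close>
    define j where "j = nat (\<lceil>(\<beta> * of_int (m k) + b/2 - x) / p\<rceil> - k)"
    \<comment> \<open>The upper bound uses \<beta> \<le> b: the next window starts after the point,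
      so this one has not yet ended.\<close>
    have u: "- b/2 \<le> u" "u < b/2" using m1[of k] \<beta> by (simp_all add: u_def)
    have up: "of_int l * p < \<beta> * of_int (m k) + b/2 - x \<longleftrightarrow> l < \<lceil>(\<beta> * of_int (m k) + b/2 - x) / p\<rceil>" for l :: int
      using p by (simp add: less_ceiling_iff pos_less_divide_eq)
    have "k < \<lceil>(\<beta> * of_int (m k) + b/2 - x) / p\<rceil>"
      using u(2) by (subst up[symmetric]) (simp add: u_def)
    then have j: "j \<ge> 1" "\<lceil>(\<beta> * of_int (m k) + b/2 - x) / p\<rceil> = k + int j" by (auto simp: j_def)
    have nz: "exp_window b w (x + of_int l * p - \<beta> * of_int (m k)) \<noteq> 0 \<longleftrightarrow> l \<in> {k..<k + int j}" for l
    proof -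
      have "- b/2 \<le> x + of_int l * p - \<beta> * of_int (m k) \<longleftrightarrow> k \<le> l"
      proof
        assume "k \<le> l"
        then have "of_int k * p \<le> of_int l * p" using p by simp
        then show "- b/2 \<le> x + of_int l * p - \<beta> * of_int (m k)" using u(1) by (simp add: u_def)
      next
        assume *: "- b/2 \<le> x + of_int l * p - \<beta> * of_int (m k)"
        show "k \<le> l"
        proof (rule ccontr)
          \<comment> \<open>An earlier lattice point lies at least p \<ge> \<beta> further left,
            hence before the start of this window.\<close>
          assume "\<not> k \<le> l"
          then have "of_int l + 1 \<le> (of_int k :: real)" by linarith
          then have "(of_int l + 1) * p \<le> of_int k * p" using p by (intro mult_right_mono) auto
          then show False using * m1(2)[of k] \<beta> by (simp add: distrib_right)
        qed
      qed
      moreover have "x + of_int l * p - \<beta> * of_int (m k) < b/2 \<longleftrightarrow> l < k + int j"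
        using up[of l] j(2) by auto
      ultimately show ?thesis unfolding exp_window_nonzero_iff by auto
    qed
    have "y (m k) = (\<Sum>\<^sub>\<infinity>l\<in>{k..<k + int j}. exp_window b w (x + of_int l * p - \<beta> * of_int (m k)) * c l)"
      unfolding y_def using nz by (intro infsum_cong_neutral) auto
    also have "\<dots> = (\<Sum>l\<in>{k..<k + int j}. exp_window b w (x + of_int l * p - \<beta> * of_int (m k)) * c l)"
      by simp
    also have "\<dots> = (\<Sum>i<j. exp_window b w (x + of_int (k + int i) * p - \<beta> * of_int (m k)) * c (k + int i))"
      by (rule sum.reindex_bij_witness[of _ "\<lambda>i. k + int i" "\<lambda>l. nat (l - k)"]) auto
    \<comment> \<open>The exponential shape enters here: along the lattice the nonzero entries of a
      row form a geometric progression of ratio \<open>r\<close>, up to one common factor.\<close>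
    also have "\<dots> = (\<Sum>i<j. of_real (exp (2 * pi * w * u)) * (of_real (r ^ i) * c (k + int i)))"
    proof (intro sum.cong refl)
      fix i assume "i \<in> {..<j}"
      then have "k + int i \<in> {k..<k + int j}" by auto
      then have "exp_window b w (x + of_int (k + int i) * p - \<beta> * of_int (m k)) = of_real (exp (2 * pi * w * (x + of_int (k + int i) * p - \<beta> * of_int (m k))))"
        using nz[of "k + int i"] unfolding exp_window_nonzero_iff by (simp add: exp_window_def)
      also have "exp (2 * pi * w * (x + of_int (k + int i) * p - \<beta> * of_int (m k))) = exp (2 * pi * w * u) * r ^ i"
        by (simp add: r_def u_def algebra_simps flip: exp_of_nat_mult exp_add)
      finally show "exp_window b w (x + of_int (k + int i) * p - \<beta> * of_int (m k)) * c (k + int i) = of_real (exp (2 * pi * w * u)) * (of_real (r ^ i) * c (k + int i))"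
        by simp
    qed
    also have "\<dots> = of_real (exp (2 * pi * w * u)) * (E k - of_real (r ^ j) * E (k + int j))"
      unfolding Esplit[of k j] by (simp add: sum_distrib_left)
    finally have yE: "y (m k) = of_real (exp (2 * pi * w * u)) * (E k - of_real (r ^ j) * E (k + int j))" .
    have "E k - of_real (r ^ j) * E (k + int j) = of_real (exp (- (2 * pi * w * u))) * y (m k)"
      unfolding yE by (simp flip: mult.assoc of_real_mult exp_add)
    then have "E k = of_real (exp (- (2 * pi * w * u))) * y (m k) + of_real (r ^ j) * E (k + int j)" by (simp add: algebra_simps)
    then have "cmod (E k) \<le> cmod (of_real (exp (- (2 * pi * w * u))) * y (m k)) + cmod (of_real (r ^ j) * E (k + int j))"
      using norm_triangle_ineq by metis
    also have "\<dots> = exp (- (2 * pi * w * u)) * cmod (y (m k)) + r ^ j * cmod (E (k + int j))"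
      using r by (simp add: norm_mult norm_power)
    also have "\<dots> \<le> M * cmod (y (m k)) + r ^ j * cmod (E (k + int j))"
    proof (intro add_right_mono mult_right_mono)
      have "(- (2 * pi * w)) * u \<le> (- (2 * pi * w)) * (b/2)"
        using u w by (intro mult_left_mono) (auto simp: mult_nonneg_nonpos)
      then show "exp (- (2 * pi * w * u)) \<le> M" by (simp add: M_def)
    qed simp
    finally show ?thesis using j(1) by blast
  qed
  define z where "z k = M\<^sup>2 * (cmod (y (m k)))\<^sup>2 / (1 - r)" for k
  have step2: "\<exists>j\<ge>1. (cmod (E k))\<^sup>2 \<le> z k + r ^ j * (cmod (E (k + int j)))\<^sup>2" for k
  proof -
    obtain j where j: "j \<ge> 1" "cmod (E k) \<le> M * cmod (y (m k)) + r ^ j * cmod (E (k + int j))" using step by blast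
    \<comment> \<open>convexity of the square, with weights matched to the ratio of the recursion\<close>
    have conv: "(s + t)\<^sup>2 \<le> s\<^sup>2 / (1 - r) + t\<^sup>2 / r" for s t
    proof -
      have "s\<^sup>2 / (1 - r) + t\<^sup>2 / r - (s + t)\<^sup>2 = (r * s - (1 - r) * t)\<^sup>2 / (r * (1 - r))"
        using r by (simp add: field_simps power2_eq_square)
      also have "\<dots> \<ge> 0" using r by simp
      finally show ?thesis by simp
    qed
    have "(cmod (E k))\<^sup>2 \<le> (M * cmod (y (m k)) + r ^ j * cmod (E (k + int j)))\<^sup>2"
      using j by (intro power_mono) auto
    also have "\<dots> \<le> (M * cmod (y (m k)))\<^sup>2 / (1 - r) + (r ^ j * cmod (E (k + int j)))\<^sup>2 / r" by (rule conv)
    also have "(M * cmod (y (m k)))\<^sup>2 / (1 - r) = z k" by (simp add: z_def power_mult_distrib)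
    \<comment> \<open>Because j \<ge> 1, the square of \<open>r ^ j\<close> contains a spare factor
      \<open>r\<close> that absorbs the division by \<open>r\<close>.\<close>
    also have "(r ^ j * cmod (E (k + int j)))\<^sup>2 / r \<le> r ^ j * (cmod (E (k + int j)))\<^sup>2"
    proof -
      obtain i where i: "j = Suc i" using j(1) by (cases j) auto
      have "(r ^ j * cmod (E (k + int j)))\<^sup>2 / r = r ^ i * (r ^ j * (cmod (E (k + int j)))\<^sup>2)"
        using r by (simp add: i power2_eq_square mult_ac)
      also have "\<dots> \<le> 1 * (r ^ j * (cmod (E (k + int j)))\<^sup>2)"
        using r by (intro mult_right_mono power_le_one) auto
      finally show ?thesis by simp
    qed
    finally show ?thesis using j(1) by auto
  qed
  have "(\<integral>\<^sup>+k. ennreal ((cmod (E k))\<^sup>2) \<partial>count_space UNIV) \<le> ennreal (1 / (1 - r)) * (\<integral>\<^sup>+k. ennreal (z k) \<partial>count_space UNIV)"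
  proof (rule geometric_recursion_sum[where B = "(C / (1 - r))\<^sup>2", OF _ _ _ _ _ step2])
    show "(cmod (E k))\<^sup>2 \<le> (C / (1 - r))\<^sup>2" for k using Ebd by (intro power_mono) auto
    show "z k \<ge> 0" for k using r by (simp add: z_def)
  qed (use r in auto)
  also have "(\<integral>\<^sup>+k. ennreal (z k) \<partial>count_space UNIV) = ennreal (M\<^sup>2 / (1 - r)) * (\<integral>\<^sup>+k. ennreal ((cmod (y (m k)))\<^sup>2) \<partial>count_space UNIV)"
    using r by (subst nn_integral_cmult[symmetric]) (auto simp: z_def simp flip: ennreal_mult)
  \<comment> \<open>Injectivity of \<open>m\<close> ensures that no row is counted twice.\<close>
  also have "(\<integral>\<^sup>+k. ennreal ((cmod (y (m k)))\<^sup>2) \<partial>count_space UNIV) = (\<integral>\<^sup>+n. ennreal ((cmod (y n))\<^sup>2) \<partial>count_space (range m))"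
    using inj by (intro nn_integral_bij_count_space) (auto simp: bij_betw_def)
  also have "\<dots> \<le> (\<integral>\<^sup>+n. ennreal ((cmod (y n))\<^sup>2) \<partial>count_space UNIV)"
    by (auto simp: nn_integral_count_space_indicator intro!: nn_integral_mono split: split_indicator)
  finally have E: "(\<integral>\<^sup>+k. ennreal ((cmod (E k))\<^sup>2) \<partial>count_space UNIV) \<le> ennreal (1 / (1 - r)) * (ennreal (M\<^sup>2 / (1 - r)) * (\<integral>\<^sup>+n. ennreal ((cmod (y n))\<^sup>2) \<partial>count_space UNIV))"
    by (simp add: mult_left_mono)
  have "(\<integral>\<^sup>+k. ennreal ((cmod (c k))\<^sup>2) \<partial>count_space UNIV) \<le> (\<integral>\<^sup>+k. ennreal 2 * ennreal ((cmod (E k))\<^sup>2) + ennreal 2 * ennreal ((cmod (E (k + 1)))\<^sup>2) \<partial>count_space UNIV)"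
  proof (rule nn_integral_mono)
    fix k
    have "c k = E k - of_real r * E (k + 1)" using Esplit[of k 1] by simp
    then have "cmod (c k) \<le> cmod (E k) + r * cmod (E (k + 1))"
      using norm_triangle_ineq4[of "E k" "of_real r * E (k + 1)"] r by (simp add: norm_mult)
    also have "\<dots> \<le> cmod (E k) + 1 * cmod (E (k + 1))" using r by (intro add_left_mono mult_right_mono) auto
    finally have "(cmod (c k))\<^sup>2 \<le> (cmod (E k) + cmod (E (k + 1)))\<^sup>2" by (intro power_mono) auto
    also have "\<dots> \<le> 2 * (cmod (E k))\<^sup>2 + 2 * (cmod (E (k + 1)))\<^sup>2"
      using sum_squares_bound[of "cmod (E k)" "cmod (E (k + 1))"] by (simp add: power2_sum)
    finally have "ennreal ((cmod (c k))\<^sup>2) \<le> ennreal (2 * (cmod (E k))\<^sup>2 + 2 * (cmod (E (k + 1)))\<^sup>2)"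
      by (rule ennreal_leI)
    then show "ennreal ((cmod (c k))\<^sup>2) \<le> ennreal 2 * ennreal ((cmod (E k))\<^sup>2) + ennreal 2 * ennreal ((cmod (E (k + 1)))\<^sup>2)"
      by (simp add: ennreal_mult)
  qed
  also have "\<dots> = ennreal 4 * (\<integral>\<^sup>+k. ennreal ((cmod (E k))\<^sup>2) \<partial>count_space UNIV)"
  proof -
    have "(\<integral>\<^sup>+k. ennreal ((cmod (E (k + 1)))\<^sup>2) \<partial>count_space UNIV) = (\<integral>\<^sup>+k. ennreal ((cmod (E k))\<^sup>2) \<partial>count_space UNIV)"
      by (rule nn_sum_shift)
    then show ?thesis
      by (simp add: nn_integral_add nn_integral_cmult flip: distrib_right)
  qed
  also have "\<dots> \<le> ennreal 4 * (ennreal (1 / (1 - r)) * (ennreal (M\<^sup>2 / (1 - r)) * (\<integral>\<^sup>+n. ennreal ((cmod (y n))\<^sup>2) \<partial>count_space UNIV)))"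
    by (intro mult_left_mono E) auto
  also have "\<dots> = ennreal (4 * ((1 / (1 - r)) * (M\<^sup>2 / (1 - r)))) * (\<integral>\<^sup>+n. ennreal ((cmod (y n))\<^sup>2) \<partial>count_space UNIV)"
    using r by (simp only: ennreal_mult[of 4] ennreal_mult[of "1 / (1 - r)"] mult.assoc divide_nonneg_nonneg
        mult_nonneg_nonneg zero_le_power2 zero_le_one diff_ge_0_iff_ge less_imp_le zero_le_numeral)
  also have "4 * ((1 / (1 - r)) * (M\<^sup>2 / (1 - r))) = 4 * exp (- 2 * pi * w * b) / (1 - r)\<^sup>2"
    by (simp add: M_def power2_eq_square flip: exp_add)
  finally show ?thesis unfolding y_def .
qed

subsection \<open>Energy of the Gabor coefficients\<close>

text \<open>The function whose \<open>FT\<close> is a time-frequency shift of g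
  (\<open>tf_shift_FT_window\<close>): a frequency shift becomes a translation of the window, a time
  shift becomes a phase.\<close>

definition gabor_atom :: "real \<Rightarrow> real \<Rightarrow> real \<Rightarrow> real \<Rightarrow> real \<Rightarrow> complex" where
  "gabor_atom b w x \<omega> \<xi> = pi * (exp_window b w (\<xi> - \<omega>) * cis (- 2 * pi * (\<xi> - \<omega>) * x))"

lemma exp_window_measurable [measurable]: "exp_window b w \<in> borel_measurable borel"
  unfolding exp_window_def[abs_def] by measurable

lemma tame_gabor_atom:
  assumes "w < 0" shows "tame (gabor_atom b w x \<omega>)"
  unfolding gabor_atom_def[abs_def]
  using tame_shift[OF tame_exp_window[OF assms], of b "- \<omega>"]
  by (intro tame_cmult tame_mult[where K = 1]) auto

lemma tf_shift_FT_window: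
  "tf_shift x \<omega> (\<lambda>t. pi * FT (exp_window b w) t) = FT (gabor_atom b w x \<omega>)"
proof
  fix t
  have "FT (gabor_atom b w x \<omega>) t = (LINT \<xi>|lborel. gabor_atom b w x \<omega> (\<omega> + 1 * \<xi>) * cis (2 * pi * (\<omega> + 1 * \<xi>) * t))"
    unfolding FT_def using lborel_integral_real_affine[of 1 "\<lambda>\<xi>. gabor_atom b w x \<omega> \<xi> * cis (2 * pi * \<xi> * t)" \<omega>] by simp
  also have "\<dots> = (LINT \<xi>|lborel. (cis (2 * pi * \<omega> * t) * pi) * (exp_window b w \<xi> * cis (2 * pi * \<xi> * (t - x))))"
    by (intro Bochner_Integration.integral_cong refl) (simp add: gabor_atom_def cis_mult algebra_simps)
  also have "\<dots> = (cis (2 * pi * \<omega> * t) * pi) * FT (exp_window b w) (t - x)"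
    unfolding FT_def by (rule integral_mult_right_zero)
  also have "\<dots> = tf_shift x \<omega> (\<lambda>t. pi * FT (exp_window b w) t) t"
    by (simp add: tf_shift_def cis_conv_exp mult_ac)
  finally show "tf_shift x \<omega> (\<lambda>t. pi * FT (exp_window b w) t) t = FT (gabor_atom b w x \<omega>) t" ..
qed

lemma FT_exp_window:
  assumes w: "w < 0" and b: "b > 0"
  shows "pi * FT (exp_window b w) t = sin (of_real (pi * b) * (of_real t - \<i> * of_real w)) / (of_real t - \<i> * of_real w)"
proof -
  \<comment> \<open>Decay and oscillation merge into one complex exponent, which is nonzero because
    w \<noteq> 0; the integral is then elementary.\<close>
  define c where "c = 2 * pi * \<i> * (of_real t - \<i> * of_real w)"
  have nz: "of_real t - \<i> * of_real w \<noteq> 0" using w by (auto simp: complex_eq_iff)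
  then have c: "c \<noteq> 0" by (simp add: c_def)
  have "FT (exp_window b w) t = (LINT \<xi>|lborel. indicator {-b/2..b/2} \<xi> *\<^sub>R exp (c * of_real \<xi>))"
    unfolding FT_def
  proof (rule Bochner_Integration.integral_cong_AE)
    \<comment> \<open>The half-open and the closed support differ only in the point
      \<open>b/2\<close>, a null set.\<close>
    have "AE \<xi> in lborel. \<xi> \<noteq> b/2" by (rule AE_lborel_singleton)
    then show "AE \<xi> in lborel. exp_window b w \<xi> * cis (2 * pi * \<xi> * t) = indicator {-b/2..b/2} \<xi> *\<^sub>R exp (c * of_real \<xi>)"
    proof eventually_elim
      case (elim \<xi>)
      have "exp (c * of_real \<xi>) = of_real (exp (2 * pi * w * \<xi>)) * cis (2 * pi * \<xi> * t)"
        by (simp add: c_def cis_conv_exp algebra_simps flip: exp_of_real exp_add)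
      then show ?case using elim by (auto simp: exp_window_def indicator_def)
    qed
  qed measurable
  also have "\<dots> = exp (c * of_real (b/2)) / c - exp (c * of_real (-b/2)) / c"
  proof (rule integral_FTC_Icc)
    fix x :: real
    have "((\<lambda>z. exp (c * z) / c) has_field_derivative exp (c * of_real x)) (at (of_real x))"
      using c by (auto intro!: derivative_eq_intros)
    from has_vector_derivative_real_field[OF this, of "{-b/2..b/2}"]
    show "((\<lambda>x. exp (c * of_real x) / c) has_vector_derivative exp (c * of_real x)) (at x within {-b/2..b/2})" .
  qed (use b in \<open>auto intro!: continuous_intros\<close>)
  also have "\<dots> = (exp (c * of_real (b/2)) - exp (- (c * of_real (b/2)))) / c"
    by (simp add: diff_divide_distrib)
  also have "c * of_real (b/2) = \<i> * (of_real (pi * b) * (of_real t - \<i> * of_real w))"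
    by (simp add: c_def)
  finally have eq: "FT (exp_window b w) t = (exp (\<i> * (of_real (pi * b) * (of_real t - \<i> * of_real w))) -
      exp (- (\<i> * (of_real (pi * b) * (of_real t - \<i> * of_real w))))) / c" .
  have "of_real pi * (X / (2 * of_real pi * \<i> * z)) = X / (2 * \<i>) / z" if "z \<noteq> 0" for X z :: complex
    using that by (simp add: divide_divide_eq_left[symmetric] del: divide_divide_eq_left)
  from this[OF nz] show ?thesis unfolding eq sin_exp_eq c_def by simp
qed

text \<open>Up to a factor of modulus pi, the coefficients for one frequency shift are samples of a
  single Fourier transform at the time shifts, which is the form required by
  \<open>poisson_parseval\<close>.\<close>

lemma l2_inner_gabor_atom:
  "l2_inner F (gabor_atom b w x \<omega>) = pi * cis (- 2 * pi * \<omega> * x) * FT (\<lambda>\<xi>. F \<xi> * exp_window b w (\<xi> - \<omega>)) x"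
proof -
  have "l2_inner F (gabor_atom b w x \<omega>) = (LINT \<xi>|lborel. (pi * cis (- 2 * pi * \<omega> * x)) * (F \<xi> * exp_window b w (\<xi> - \<omega>) * cis (2 * pi * \<xi> * x)))"
    unfolding l2_inner_def
  proof (intro Bochner_Integration.integral_cong refl)
    fix \<xi>
    have "cnj (exp_window b w (\<xi> - \<omega>)) = exp_window b w (\<xi> - \<omega>)" by (simp add: exp_window_def indicator_def)
    moreover have "cis (2 * pi * (\<xi> - \<omega>) * x) = cis (- 2 * pi * \<omega> * x) * cis (2 * pi * \<xi> * x)"
      by (simp add: cis_mult algebra_simps)
    ultimately show "F \<xi> * cnj (gabor_atom b w x \<omega> \<xi>) = pi * cis (- 2 * pi * \<omega> * x) * (F \<xi> * exp_window b w (\<xi> - \<omega>) * cis (2 * pi * \<xi> * x))"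
      by (simp add: gabor_atom_def cis_cnj mult_ac)
  qed
  then show ?thesis by (simp add: FT_def)
qed

abbreviation coef_energy :: "(real \<Rightarrow> complex) \<Rightarrow> (int \<times> int \<Rightarrow> real \<Rightarrow> complex) \<Rightarrow> ennreal" where
  "coef_energy f u \<equiv> (\<integral>\<^sup>+i. ennreal ((cmod (l2_inner f (u i)))\<^sup>2) \<partial>count_space UNIV)"

text \<open>Apply \<open>poisson_parseval\<close> for every \<open>m\<close> with period 1/\<alpha>,
  then exchange sum and integral. \<open>F\<close> is only assumed bounded and measurable, because
  it will be the transform of a tame function; the window supplies the bounded support.\<close>

lemma gabor_energy:
  assumes w: "w < 0" and \<alpha>: "\<alpha> > 0" and [measurable]: "F \<in> borel_measurable borel" and F: "\<And>\<xi>. cmod (F \<xi>) \<le> C"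
  shows "coef_energy F (\<lambda>(m, n). gabor_atom b w (\<alpha> * of_int n) (\<beta> * of_int m)) =
    ennreal (pi\<^sup>2 / \<alpha>) * (\<integral>\<^sup>+x. indicator {0..<1/\<alpha>} x *
      (\<integral>\<^sup>+m. ennreal ((cmod (\<Sum>\<^sub>\<infinity>k. exp_window b w (x + of_int k * (1/\<alpha>) - \<beta> * of_int m) * F (x + of_int k * (1/\<alpha>))))\<^sup>2) \<partial>count_space UNIV) \<partial>lborel)"
proof -
  define h where "h m \<xi> = exp_window b w (\<xi> - \<beta> * of_int m) * F \<xi>" for m \<xi>
  have h: "tame (h m)" for m
    unfolding h_def using tame_shift[OF tame_exp_window[OF w, of b], of "- (\<beta> * of_int m)"] F
    by (intro tame_mult[where K = C]) auto
  have p: "1 / \<alpha> > 0" using \<alpha> by simp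
  \<comment> \<open>Measurability in \<open>x\<close> of the infinite sum is inherited from the
    periodization, which is tame.\<close>
  have meas: "(\<lambda>x. indicator {0..<1/\<alpha>} x * ennreal ((cmod (\<Sum>\<^sub>\<infinity>k. h m (x + of_int k * (1/\<alpha>))))\<^sup>2)) \<in> borel_measurable lborel" for m
  proof -
    have "(\<lambda>x. indicator {0..<1/\<alpha>} x * ennreal ((cmod (\<Sum>\<^sub>\<infinity>k. h m (x + of_int k * (1/\<alpha>))))\<^sup>2)) =
       (\<lambda>x. ennreal ((cmod (indicator {0..<1/\<alpha>} x * (\<Sum>\<^sub>\<infinity>k. h m (x + of_int k * (1/\<alpha>)))))\<^sup>2))"
      by (auto simp: indicator_def)
    moreover have "(\<lambda>x. indicator {0..<1/\<alpha>} x * (\<Sum>\<^sub>\<infinity>k. h m (x + of_int k * (1/\<alpha>)))) \<in> borel_measurable borel"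
      using tame_periodization(1)[OF h p] by (simp add: tame_def)
    ultimately show ?thesis by simp
  qed
  have "coef_energy F (\<lambda>(m, n). gabor_atom b w (\<alpha> * of_int n) (\<beta> * of_int m)) =
    (\<integral>\<^sup>+m. (\<integral>\<^sup>+n. ennreal ((cmod (l2_inner F (gabor_atom b w (\<alpha> * of_int n) (\<beta> * of_int m))))\<^sup>2) \<partial>count_space UNIV) \<partial>count_space UNIV)"
    by (subst nn_integral_fst_count_space[symmetric]) simp
  also have "\<dots> = (\<integral>\<^sup>+m. (\<integral>\<^sup>+n. ennreal (pi\<^sup>2) * ennreal ((cmod (FT (h m) (of_int n / (1/\<alpha>))))\<^sup>2) \<partial>count_space UNIV) \<partial>count_space UNIV)"
    by (simp add: l2_inner_gabor_atom norm_mult power_mult_distrib ennreal_mult h_def[abs_def] mult.commute)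
  also have "\<dots> = (\<integral>\<^sup>+m. ennreal (pi\<^sup>2) * (ennreal (1/\<alpha>) * (\<integral>\<^sup>+x. indicator {0..<1/\<alpha>} x * ennreal ((cmod (\<Sum>\<^sub>\<infinity>k. h m (x + of_int k * (1/\<alpha>))))\<^sup>2) \<partial>lborel)) \<partial>count_space UNIV)"
    by (simp only: poisson_parseval[OF h p] nn_integral_cmult measurable_count_space borel_measurable_count_space)
  also have "\<dots> = ennreal (pi\<^sup>2) * (ennreal (1/\<alpha>) * (\<integral>\<^sup>+m. (\<integral>\<^sup>+x. indicator {0..<1/\<alpha>} x * ennreal ((cmod (\<Sum>\<^sub>\<infinity>k. h m (x + of_int k * (1/\<alpha>))))\<^sup>2) \<partial>lborel) \<partial>count_space UNIV))"
    by (simp only: nn_integral_cmult borel_measurable_count_space)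
  also have "(\<integral>\<^sup>+m. (\<integral>\<^sup>+x. indicator {0..<1/\<alpha>} x * ennreal ((cmod (\<Sum>\<^sub>\<infinity>k. h m (x + of_int k * (1/\<alpha>))))\<^sup>2) \<partial>lborel) \<partial>count_space UNIV) =
     (\<integral>\<^sup>+x. (\<integral>\<^sup>+m. indicator {0..<1/\<alpha>} x * ennreal ((cmod (\<Sum>\<^sub>\<infinity>k. h m (x + of_int k * (1/\<alpha>))))\<^sup>2) \<partial>count_space UNIV) \<partial>lborel)"
    by (rule nn_sum_swap[symmetric, OF meas])
  also have "\<dots> = (\<integral>\<^sup>+x. indicator {0..<1/\<alpha>} x * (\<integral>\<^sup>+m. ennreal ((cmod (\<Sum>\<^sub>\<infinity>k. h m (x + of_int k * (1/\<alpha>))))\<^sup>2) \<partial>count_space UNIV) \<partial>lborel)"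
    by (simp only: nn_integral_cmult borel_measurable_count_space)
  also have "ennreal (pi\<^sup>2) * (ennreal (1/\<alpha>) * \<dots>) = ennreal (pi\<^sup>2 / \<alpha>) * \<dots>"
    using \<alpha> by (simp add: mult.assoc[symmetric] flip: ennreal_mult)
  finally show ?thesis unfolding h_def .
qed

text \<open>The matrix estimate holds on each fibre \<open>x + \<int>/\<alpha>\<close> with a
  constant independent of \<open>x\<close>; integrating over a period and undoing the tiling
  restores the L2 norm. The lower bound is assembled in the same way.\<close>

lemma gabor_energy_upper:
  assumes b: "b > 0" and w: "w < 0" and \<alpha>: "\<alpha> > 0" and \<beta>: "\<beta> > 0"
  obtains B where "B > 0"
    "\<And>F C. F \<in> borel_measurable borel \<Longrightarrow> (\<And>\<xi>. cmod (F \<xi>) \<le> C) \<Longrightarrow>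
      coef_energy F (\<lambda>(m, n). gabor_atom b w (\<alpha> * of_int n) (\<beta> * of_int m)) \<le> ennreal B * (\<integral>\<^sup>+\<xi>. ennreal ((cmod (F \<xi>))\<^sup>2) \<partial>lborel)"
proof -
  define K where "K = (b / (1/\<alpha>) + 1) * (exp (- pi * w * b))\<^sup>2 * (b / \<beta> + 1)"
  have p: "1 / \<alpha> > 0" using \<alpha> by simp
  have K: "K > 0" using b \<alpha> \<beta> by (auto simp: K_def intro!: mult_pos_pos add_pos_pos)
  show ?thesis
  proof (rule that[of "pi\<^sup>2 / \<alpha> * K"])
    show "pi\<^sup>2 / \<alpha> * K > 0" using K \<alpha> by simp
    fix F :: "real \<Rightarrow> complex" and C
    assume [measurable]: "F \<in> borel_measurable borel" and F: "\<And>\<xi>. cmod (F \<xi>) \<le> C"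
    have "coef_energy F (\<lambda>(m, n). gabor_atom b w (\<alpha> * of_int n) (\<beta> * of_int m)) \<le>
      ennreal (pi\<^sup>2 / \<alpha>) * (\<integral>\<^sup>+x. indicator {0..<1/\<alpha>} x * (ennreal K * (\<integral>\<^sup>+k. ennreal ((cmod (F (x + of_int k * (1/\<alpha>))))\<^sup>2) \<partial>count_space UNIV)) \<partial>lborel)"
      unfolding gabor_energy[OF w \<alpha> \<open>F \<in> _\<close> F] K_def
      by (intro mult_left_mono nn_integral_mono gabor_matrix_upper b w p \<beta>) auto
    also have "\<dots> = ennreal (pi\<^sup>2 / \<alpha>) * (ennreal K * (\<integral>\<^sup>+x. indicator {0..<1/\<alpha>} x * (\<integral>\<^sup>+k. ennreal ((cmod (F (x + of_int k * (1/\<alpha>))))\<^sup>2) \<partial>count_space UNIV) \<partial>lborel))"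
      by (subst nn_integral_cmult[symmetric]) (auto simp: mult_ac)
    also have "(\<integral>\<^sup>+x. indicator {0..<1/\<alpha>} x * (\<integral>\<^sup>+k. ennreal ((cmod (F (x + of_int k * (1/\<alpha>))))\<^sup>2) \<partial>count_space UNIV) \<partial>lborel) = (\<integral>\<^sup>+\<xi>. ennreal ((cmod (F \<xi>))\<^sup>2) \<partial>lborel)"
      by (rule nn_integral_tiling[OF p, symmetric]) measurable
    also have "ennreal (pi\<^sup>2 / \<alpha>) * (ennreal K * \<dots>) = ennreal (pi\<^sup>2 / \<alpha> * K) * \<dots>"
      using \<alpha> K by (simp only: ennreal_mult[of "pi\<^sup>2 / \<alpha>"] mult.assoc divide_nonneg_nonneg zero_le_power2 less_imp_le)
    finally show "coef_energy F (\<lambda>(m, n). gabor_atom b w (\<alpha> * of_int n) (\<beta> * of_int m)) \<le> ennreal (pi\<^sup>2 / \<alpha> * K) * (\<integral>\<^sup>+\<xi>. ennreal ((cmod (F \<xi>))\<^sup>2) \<partial>lborel)" .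
  qed
qed

lemma gabor_energy_lower:
  assumes b: "b > 0" and w: "w < 0" and \<alpha>: "\<alpha> > 0" and \<beta>: "\<beta> > 0" "\<beta> \<le> b" "\<alpha> * \<beta> \<le> 1"
  obtains A where "A > 0"
    "\<And>F C. F \<in> borel_measurable borel \<Longrightarrow> (\<And>\<xi>. cmod (F \<xi>) \<le> C) \<Longrightarrow>
      ennreal A * (\<integral>\<^sup>+\<xi>. ennreal ((cmod (F \<xi>))\<^sup>2) \<partial>lborel) \<le> coef_energy F (\<lambda>(m, n). gabor_atom b w (\<alpha> * of_int n) (\<beta> * of_int m))"
proof -
  define r where "r = exp (2 * pi * w * (1/\<alpha>))"
  define K where "K = 4 * exp (- 2 * pi * w * b) / (1 - r)\<^sup>2"
  have p: "1 / \<alpha> > 0" using \<alpha> by simp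
  \<comment> \<open>The density condition is the hypothesis \<beta> \<le> p of the matrix
    estimate.\<close>
  have \<beta>p: "\<beta> \<le> 1 / \<alpha>" using \<alpha> \<beta> by (simp add: field_simps)
  have "r < 1" using w p by (simp add: r_def mult_neg_pos divide_neg_pos mult_pos_neg)
  then have K: "K > 0" by (auto simp: K_def)
  show ?thesis
  proof (rule that[of "pi\<^sup>2 / \<alpha> / K"])
    show "pi\<^sup>2 / \<alpha> / K > 0" using K \<alpha> by simp
    fix F :: "real \<Rightarrow> complex" and C
    assume [measurable]: "F \<in> borel_measurable borel" and F: "\<And>\<xi>. cmod (F \<xi>) \<le> C"
    have tile: "(\<integral>\<^sup>+\<xi>. ennreal ((cmod (F \<xi>))\<^sup>2) \<partial>lborel) = (\<integral>\<^sup>+x. indicator {0..<1/\<alpha>} x * (\<integral>\<^sup>+k. ennreal ((cmod (F (x + of_int k * (1/\<alpha>))))\<^sup>2) \<partial>count_space UNIV) \<partial>lborel)"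
      by (rule nn_integral_tiling[OF p]) measurable
    have "ennreal (pi\<^sup>2 / \<alpha> / K) * (\<integral>\<^sup>+\<xi>. ennreal ((cmod (F \<xi>))\<^sup>2) \<partial>lborel) =
       ennreal (pi\<^sup>2 / \<alpha>) * (\<integral>\<^sup>+x. indicator {0..<1/\<alpha>} x * (ennreal (1 / K) * (\<integral>\<^sup>+k. ennreal ((cmod (F (x + of_int k * (1/\<alpha>))))\<^sup>2) \<partial>count_space UNIV)) \<partial>lborel)"
    proof -
      have "ennreal (pi\<^sup>2 / \<alpha> / K) = ennreal (pi\<^sup>2 / \<alpha>) * ennreal (1 / K)"
        using \<alpha> K by (subst ennreal_mult[symmetric]) auto
      moreover have "ennreal (1 / K) * (\<integral>\<^sup>+x. indicator {0..<1/\<alpha>} x * (\<integral>\<^sup>+k. ennreal ((cmod (F (x + of_int k * (1/\<alpha>))))\<^sup>2) \<partial>count_space UNIV) \<partial>lborel) =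
          (\<integral>\<^sup>+x. indicator {0..<1/\<alpha>} x * (ennreal (1 / K) * (\<integral>\<^sup>+k. ennreal ((cmod (F (x + of_int k * (1/\<alpha>))))\<^sup>2) \<partial>count_space UNIV)) \<partial>lborel)"
        by (subst nn_integral_cmult[symmetric]) (auto simp: mult_ac)
      ultimately show ?thesis using tile by (simp add: mult.assoc)
    qed
    also have "\<dots> \<le> coef_energy F (\<lambda>(m, n). gabor_atom b w (\<alpha> * of_int n) (\<beta> * of_int m))"
      unfolding gabor_energy[OF w \<alpha> \<open>F \<in> _\<close> F]
    proof (intro mult_left_mono nn_integral_mono)
      fix x
      have "ennreal (1 / K) * (\<integral>\<^sup>+k. ennreal ((cmod (F (x + of_int k * (1/\<alpha>))))\<^sup>2) \<partial>count_space UNIV) \<le>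
        ennreal (1 / K) * (ennreal K * (\<integral>\<^sup>+m. ennreal ((cmod (\<Sum>\<^sub>\<infinity>k. exp_window b w (x + of_int k * (1/\<alpha>) - \<beta> * of_int m) * F (x + of_int k * (1/\<alpha>))))\<^sup>2) \<partial>count_space UNIV))"
        unfolding K_def r_def using F by (intro mult_left_mono gabor_matrix_lower[OF b w p \<beta>(1,2) \<beta>p]) auto
      also have "\<dots> = (\<integral>\<^sup>+m. ennreal ((cmod (\<Sum>\<^sub>\<infinity>k. exp_window b w (x + of_int k * (1/\<alpha>) - \<beta> * of_int m) * F (x + of_int k * (1/\<alpha>))))\<^sup>2) \<partial>count_space UNIV)"
        using K by (simp add: mult.assoc[symmetric] flip: ennreal_mult)
      finally show "ennreal (1 / K) * (\<integral>\<^sup>+k. ennreal ((cmod (F (x + of_int k * (1/\<alpha>))))\<^sup>2) \<partial>count_space UNIV) \<le>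
        (\<integral>\<^sup>+m. ennreal ((cmod (\<Sum>\<^sub>\<infinity>k. exp_window b w (x + of_int k * (1/\<alpha>) - \<beta> * of_int m) * F (x + of_int k * (1/\<alpha>))))\<^sup>2) \<partial>count_space UNIV)" .
    qed auto
    finally show "ennreal (pi\<^sup>2 / \<alpha> / K) * (\<integral>\<^sup>+\<xi>. ennreal ((cmod (F \<xi>))\<^sup>2) \<partial>lborel) \<le> coef_energy F (\<lambda>(m, n). gabor_atom b w (\<alpha> * of_int n) (\<beta> * of_int m))" .
  qed
qed

subsection \<open>Sufficiency\<close>

definition truncate :: "nat \<Rightarrow> (real \<Rightarrow> complex) \<Rightarrow> real \<Rightarrow> complex" where
  "truncate N f t = (if \<bar>t\<bar> \<le> real N \<and> cmod (f t) \<le> real N then f t else 0)"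

lemma truncate_measurable [measurable]:
  assumes [measurable]: "f \<in> borel_measurable borel"
  shows "truncate N f \<in> borel_measurable borel"
  unfolding truncate_def[abs_def] by measurable

lemma tame_truncate: "f \<in> borel_measurable borel \<Longrightarrow> tame (truncate N f)"
  unfolding tame_def by (auto intro!: exI[of _ "real N"] simp: truncate_def)

lemma cmod_truncate_le: "cmod (truncate N f t) \<le> cmod (f t)" "cmod (f t - truncate N f t) \<le> cmod (f t)"
  by (auto simp: truncate_def)

lemma truncate_tendsto: "(\<lambda>N. truncate N f t) \<longlonglongrightarrow> f t"
proof (rule tendsto_eventually)
  obtain M :: nat where "max \<bar>t\<bar> (cmod (f t)) \<le> real M" using real_arch_simple by blast
  then show "\<forall>\<^sub>F N in sequentially. truncate N f t = f t"
    unfolding eventually_sequentially by (intro exI[of _ M]) (auto simp: truncate_def)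
qed

lemma truncate_L2:
  assumes f: "f \<in> L2"
  shows "truncate N f \<in> L2" "(\<lambda>t. f t - truncate N f t) \<in> L2"
proof -
  have [measurable]: "f \<in> borel_measurable borel" and i: "integrable lborel (\<lambda>t. (cmod (f t))\<^sup>2)"
    using f by (auto simp: L2_def)
  show "truncate N f \<in> L2" using tame_truncate tame_L2 by simp
  have "integrable lborel (\<lambda>t. (cmod (f t - truncate N f t))\<^sup>2)"
    by (rule Bochner_Integration.integrable_bound[OF i]) (auto intro!: power_mono cmod_truncate_le)
  then show "(\<lambda>t. f t - truncate N f t) \<in> L2" by (simp add: L2_def)
qed

text \<open>Cutting in both argument and value makes the approximants tame, while they never exceed
  \<open>f\<close> in modulus; dominated convergence then needs no dominating function beyond those
  built from \<open>f\<close> and \<open>u\<close>.\<close>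

lemma truncate_limits:
  assumes f: "f \<in> L2"
  shows "(\<lambda>N. l2_norm_sq (truncate N f)) \<longlonglongrightarrow> l2_norm_sq f"
    and "(\<lambda>N. l2_norm_sq (\<lambda>t. f t - truncate N f t)) \<longlonglongrightarrow> 0"
    and "u \<in> L2 \<Longrightarrow> (\<lambda>N. l2_inner (truncate N f) u) \<longlonglongrightarrow> l2_inner f u"
proof -
  have [measurable]: "f \<in> borel_measurable borel" and i: "integrable lborel (\<lambda>t. (cmod (f t))\<^sup>2)"
    using f by (auto simp: L2_def)
  show "(\<lambda>N. l2_norm_sq (truncate N f)) \<longlonglongrightarrow> l2_norm_sq f"
    unfolding l2_norm_sq_def
    by (rule integral_dominated_convergence[where w = "\<lambda>t. (cmod (f t))\<^sup>2"])
       (use i in \<open>auto intro!: power_mono cmod_truncate_le tendsto_intros truncate_tendsto\<close>)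
  have "(\<lambda>N. (cmod (f t - truncate N f t))\<^sup>2) \<longlonglongrightarrow> (cmod (f t - f t))\<^sup>2" for t
    by (intro tendsto_intros truncate_tendsto)
  then have lim: "(\<lambda>N. (cmod (f t - truncate N f t))\<^sup>2) \<longlonglongrightarrow> 0" for t by simp
  have "(\<lambda>N. l2_norm_sq (\<lambda>t. f t - truncate N f t)) \<longlonglongrightarrow> (LINT t|(lborel :: real measure). (0::real))"
    unfolding l2_norm_sq_def
    by (rule integral_dominated_convergence[where w = "\<lambda>t. (cmod (f t))\<^sup>2"])
       (use i lim in \<open>auto intro!: power_mono cmod_truncate_le\<close>)
  then show "(\<lambda>N. l2_norm_sq (\<lambda>t. f t - truncate N f t)) \<longlonglongrightarrow> 0" by simp
  assume u: "u \<in> L2"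
  then have [measurable]: "u \<in> borel_measurable borel" by (auto simp: L2_def)
  show "(\<lambda>N. l2_inner (truncate N f) u) \<longlonglongrightarrow> l2_inner f u"
    unfolding l2_inner_def
  proof (rule integral_dominated_convergence[where w = "\<lambda>t. norm (f t * cnj (u t))"])
    show "integrable lborel (\<lambda>t. norm (f t * cnj (u t)))"
      using L2_integrable_inner[OF f u] by simp
  qed (auto intro!: tendsto_intros truncate_tendsto mult_right_mono cmod_truncate_le simp: norm_mult)
qed

lemma l2_inner_diff_left:
  "f \<in> L2 \<Longrightarrow> h \<in> L2 \<Longrightarrow> u \<in> L2 \<Longrightarrow> l2_inner (\<lambda>t. f t - h t) u = l2_inner f u - l2_inner h u"
  unfolding l2_inner_def left_diff_distrib by (intro Bochner_Integration.integral_diff L2_integrable_inner)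

text \<open>A finite partial sum of the energy converges along the truncations, and so does its
  bound; finite sums control the whole series.\<close>

lemma bessel_extend:
  assumes u: "\<And>i. u i \<in> L2" and B: "B \<ge> 0"
    and tame: "\<And>f. tame f \<Longrightarrow> coef_energy f u \<le> ennreal (B * l2_norm_sq f)"
    and f: "f \<in> L2"
  shows "coef_energy f u \<le> ennreal (B * l2_norm_sq f)"
proof (rule nn_sum_le_finite_sums)
  fix A :: "(int \<times> int) set" assume A: "finite A"
  have [measurable]: "f \<in> borel_measurable borel" using f by (auto simp: L2_def)
  have "(\<lambda>N. \<Sum>i\<in>A. (cmod (l2_inner (truncate N f) (u i)))\<^sup>2) \<longlonglongrightarrow> (\<Sum>i\<in>A. (cmod (l2_inner f (u i)))\<^sup>2)"
    by (intro tendsto_intros truncate_limits f u)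
  moreover have "(\<lambda>N. B * l2_norm_sq (truncate N f)) \<longlonglongrightarrow> B * l2_norm_sq f"
    by (intro tendsto_intros truncate_limits f)
  moreover have "(\<Sum>i\<in>A. (cmod (l2_inner (truncate N f) (u i)))\<^sup>2) \<le> B * l2_norm_sq (truncate N f)" for N
  proof -
    have "ennreal (\<Sum>i\<in>A. (cmod (l2_inner (truncate N f) (u i)))\<^sup>2) \<le> ennreal (B * l2_norm_sq (truncate N f))"
    proof (rule order_trans)
      show "ennreal (\<Sum>i\<in>A. (cmod (l2_inner (truncate N f) (u i)))\<^sup>2) \<le> coef_energy (truncate N f) u"
        by (rule sum_le_nn_sum[OF _ A]) simp
      show "coef_energy (truncate N f) u \<le> ennreal (B * l2_norm_sq (truncate N f))"
        by (rule tame[OF tame_truncate]) measurable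
    qed
    then show ?thesis using B by (simp add: ennreal_le_iff)
  qed
  ultimately show "(\<Sum>i\<in>A. (cmod (l2_inner f (u i)))\<^sup>2) \<le> B * l2_norm_sq f"
    by (intro LIMSEQ_le) auto
qed auto

text \<open>A lower bound does not pass to limits of finite partial sums. Instead the energy of a
  truncation is compared with that of \<open>f\<close>, the difference being controlled by the upper
  bound for \<open>f - truncate N f\<close>, which tends to 0. Splitting the square costs the factor
  2.\<close>

lemma frame_lower_extend:
  assumes u: "\<And>i. u i \<in> L2" and A: "A \<ge> 0" and B: "B \<ge> 0"
    and upper: "\<And>f. f \<in> L2 \<Longrightarrow> coef_energy f u \<le> ennreal (B * l2_norm_sq f)"
    and lower: "\<And>f. tame f \<Longrightarrow> ennreal (A * l2_norm_sq f) \<le> coef_energy f u"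
    and f: "f \<in> L2"
  shows "ennreal (A / 2 * l2_norm_sq f) \<le> coef_energy f u"
proof -
  have [measurable]: "f \<in> borel_measurable borel" using f by (auto simp: L2_def)
  have "coef_energy f u < \<infinity>" using upper[OF f] by (rule order_le_less_trans) simp
  then obtain s where s: "s \<ge> 0" "coef_energy f u = ennreal s"
    by (cases "coef_energy f u") auto
  have "A * l2_norm_sq (truncate N f) \<le> 2 * s + 2 * (B * l2_norm_sq (\<lambda>t. f t - truncate N f t))" for N
  proof -
    have "ennreal (A * l2_norm_sq (truncate N f)) \<le> coef_energy (truncate N f) u"
      by (rule lower[OF tame_truncate]) measurable
    also have "\<dots> \<le> (\<integral>\<^sup>+i. ennreal 2 * ennreal ((cmod (l2_inner f (u i)))\<^sup>2) + ennreal 2 * ennreal ((cmod (l2_inner (\<lambda>t. f t - truncate N f t) (u i)))\<^sup>2) \<partial>count_space UNIV)"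
    proof (rule nn_integral_mono)
      fix i
      have "l2_inner (truncate N f) (u i) = l2_inner f (u i) - l2_inner (\<lambda>t. f t - truncate N f t) (u i)"
        using l2_inner_diff_left[OF f truncate_L2(1)[OF f] u] by simp
      then have "(cmod (l2_inner (truncate N f) (u i)))\<^sup>2 \<le> (cmod (l2_inner f (u i)) + cmod (l2_inner (\<lambda>t. f t - truncate N f t) (u i)))\<^sup>2"
        using norm_triangle_ineq4 by (intro power_mono) auto
      also have "\<dots> \<le> 2 * (cmod (l2_inner f (u i)))\<^sup>2 + 2 * (cmod (l2_inner (\<lambda>t. f t - truncate N f t) (u i)))\<^sup>2"
        using sum_squares_bound[of "cmod (l2_inner f (u i))" "cmod (l2_inner (\<lambda>t. f t - truncate N f t) (u i))"] by (simp add: power2_sum)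
      finally have "ennreal ((cmod (l2_inner (truncate N f) (u i)))\<^sup>2) \<le> ennreal (2 * (cmod (l2_inner f (u i)))\<^sup>2 + 2 * (cmod (l2_inner (\<lambda>t. f t - truncate N f t) (u i)))\<^sup>2)"
        by (rule ennreal_leI)
      then show "ennreal ((cmod (l2_inner (truncate N f) (u i)))\<^sup>2) \<le> ennreal 2 * ennreal ((cmod (l2_inner f (u i)))\<^sup>2) + ennreal 2 * ennreal ((cmod (l2_inner (\<lambda>t. f t - truncate N f t) (u i)))\<^sup>2)"
        by (simp add: ennreal_mult)
    qed
    also have "\<dots> = ennreal 2 * ennreal s + ennreal 2 * coef_energy (\<lambda>t. f t - truncate N f t) u"
      unfolding s(2)[symmetric] by (simp add: nn_integral_add nn_integral_cmult)
    also have "\<dots> \<le> ennreal 2 * ennreal s + ennreal 2 * ennreal (B * l2_norm_sq (\<lambda>t. f t - truncate N f t))"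
      by (intro add_left_mono mult_left_mono upper truncate_L2 f) auto
    also have "\<dots> = ennreal (2 * s + 2 * (B * l2_norm_sq (\<lambda>t. f t - truncate N f t)))"
      using s(1) B by (simp add: ennreal_mult)
    finally show ?thesis using s(1) B by (subst (asm) ennreal_le_iff) auto
  qed
  moreover have "(\<lambda>N. A * l2_norm_sq (truncate N f)) \<longlonglongrightarrow> A * l2_norm_sq f"
    by (intro tendsto_intros truncate_limits f)
  moreover have "(\<lambda>N. 2 * s + 2 * (B * l2_norm_sq (\<lambda>t. f t - truncate N f t))) \<longlonglongrightarrow> 2 * s + 2 * (B * 0)"
    by (intro tendsto_intros truncate_limits f)
  ultimately have "A * l2_norm_sq f \<le> 2 * s + 2 * (B * 0)" by (intro LIMSEQ_le) auto
  then show ?thesis unfolding s(2) by (intro ennreal_leI) simp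
qed

section \<open>Frame bounds for the exponential window\<close>

lemma gabor_frameI:
  assumes "A > 0" "B > 0"
    and "\<And>f. f \<in> L2 \<Longrightarrow> ennreal (A * l2_norm_sq f) \<le> coef_energy f (\<lambda>(m, n). tf_shift (\<alpha> * of_int n) (\<beta> * of_int m) g)"
    and "\<And>f. f \<in> L2 \<Longrightarrow> coef_energy f (\<lambda>(m, n). tf_shift (\<alpha> * of_int n) (\<beta> * of_int m) g) \<le> ennreal (B * l2_norm_sq f)"
  shows "gabor_frame g \<alpha> \<beta>"
  unfolding gabor_frame_def
proof (intro exI conjI ballI)
  fix f assume f: "f \<in> L2"
  let ?c = "\<lambda>i. (cmod (l2_inner f (case i of (m, n) \<Rightarrow> tf_shift (\<alpha> * of_int n) (\<beta> * of_int m) g)))\<^sup>2"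
  have c: "(\<lambda>(m::int, n::int). (cmod (l2_inner f (tf_shift (\<alpha> * of_int n) (\<beta> * of_int m) g)))\<^sup>2) = ?c"
    by auto
  have "(\<integral>\<^sup>+i. ennreal (?c i) \<partial>count_space UNIV) < \<infinity>"
    using assms(4)[OF f] by (rule order_le_less_trans) simp
  then have s: "?c summable_on UNIV" by (intro nn_sum_finite_imp_summable) auto
  have eq: "(\<integral>\<^sup>+i. ennreal (?c i) \<partial>count_space UNIV) = ennreal (infsum ?c UNIV)"
    by (rule nn_sum_summable[OF _ s]) auto
  have p: "infsum ?c UNIV \<ge> 0" by (rule infsum_nonneg) auto
  show "(\<lambda>(m::int, n::int). (cmod (l2_inner f (tf_shift (\<alpha> * of_int n) (\<beta> * of_int m) g)))\<^sup>2) summable_on UNIV"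
    unfolding c by (rule s)
  show "A * l2_norm_sq f \<le> (\<Sum>\<^sub>\<infinity>(m::int, n::int)\<in>UNIV. (cmod (l2_inner f (tf_shift (\<alpha> * of_int n) (\<beta> * of_int m) g)))\<^sup>2)"
    unfolding c using assms(3)[OF f] p unfolding eq by (simp add: ennreal_le_iff)
  show "(\<Sum>\<^sub>\<infinity>(m::int, n::int)\<in>UNIV. (cmod (l2_inner f (tf_shift (\<alpha> * of_int n) (\<beta> * of_int m) g)))\<^sup>2) \<le> B * l2_norm_sq f"
    unfolding c using assms(2) assms(4)[OF f] p unfolding eq by (simp add: ennreal_le_iff)
qed (use assms in auto)

lemma nn_integral_reflect:
  assumes [measurable]: "u \<in> borel_measurable borel"
  shows "(\<integral>\<^sup>+x. u (- x) \<partial>lborel) = (\<integral>\<^sup>+(x::real). u x \<partial>lborel)"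
  using nn_integral_real_affine[of u "-1" 0] by simp

lemma exp_window_gabor_frame:
  assumes b: "b > 0" and w: "w < 0" and \<alpha>: "\<alpha> > 0" and \<beta>: "\<beta> > 0" "\<beta> \<le> b" "\<alpha> * \<beta> \<le> 1"
  shows "gabor_frame (\<lambda>t. pi * FT (exp_window b w) t) \<alpha> \<beta>"
proof -
  let ?a = "\<lambda>(m, n). gabor_atom b w (\<alpha> * of_int n) (\<beta> * of_int m)"
  let ?u = "\<lambda>(m, n). tf_shift (\<alpha> * of_int n) (\<beta> * of_int m) (\<lambda>t. pi * FT (exp_window b w) t)"
  obtain A where A: "A > 0" "\<And>F C. F \<in> borel_measurable borel \<Longrightarrow> (\<And>\<xi>. cmod (F \<xi>) \<le> C) \<Longrightarrow>
      ennreal A * (\<integral>\<^sup>+\<xi>. ennreal ((cmod (F \<xi>))\<^sup>2) \<partial>lborel) \<le> coef_energy F ?a"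
    using gabor_energy_lower[OF b w \<alpha> \<beta>] by blast
  obtain B where B: "B > 0" "\<And>F C. F \<in> borel_measurable borel \<Longrightarrow> (\<And>\<xi>. cmod (F \<xi>) \<le> C) \<Longrightarrow>
      coef_energy F ?a \<le> ennreal B * (\<integral>\<^sup>+\<xi>. ennreal ((cmod (F \<xi>))\<^sup>2) \<partial>lborel)"
    using gabor_energy_upper[OF b w \<alpha> \<beta>(1)] by blast
  have uL2: "?u i \<in> L2" for i
    by (auto simp: split_beta tf_shift_FT_window intro!: FT_L2 tame_gabor_atom w)
  \<comment> \<open>Transfer to the Fourier side: the coefficients of \<open>f\<close> against the
    system are those of its reflected transform against the atoms, and Plancherel preserves the
    norm. The transform is bounded by \<open>cmod_FT_le\<close>, as the energy estimates
    require.\<close>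
  have E: "coef_energy f ?u = coef_energy (\<lambda>s. FT f (- s)) ?a"
     "(\<integral>\<^sup>+\<xi>. ennreal ((cmod (FT f (- \<xi>)))\<^sup>2) \<partial>lborel) = ennreal (l2_norm_sq f)"
     "(\<lambda>s. FT f (- s)) \<in> borel_measurable borel" if f: "tame f" for f
  proof -
    show "coef_energy f ?u = coef_energy (\<lambda>s. FT f (- s)) ?a"
      by (intro nn_integral_cong) (auto simp: tf_shift_FT_window FT_multiplication_formula[OF f tame_gabor_atom[OF w]])
    have [measurable]: "f \<in> borel_measurable borel" using f by (simp add: tame_def)
    show "(\<lambda>s. FT f (- s)) \<in> borel_measurable borel" by measurable
    show "(\<integral>\<^sup>+\<xi>. ennreal ((cmod (FT f (- \<xi>)))\<^sup>2) \<partial>lborel) = ennreal (l2_norm_sq f)"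
      using nn_integral_reflect[of "\<lambda>s. ennreal ((cmod (FT f s))\<^sup>2)"] plancherel[OF f] nn_l2_norm_sq[OF tame_L2[OF f]] by simp
  qed
  have up: "coef_energy f ?u \<le> ennreal (B * l2_norm_sq f)" if "f \<in> L2" for f
  proof (rule bessel_extend[OF uL2 _ _ that])
    fix f assume f: "tame f"
    show "coef_energy f ?u \<le> ennreal (B * l2_norm_sq f)"
      using B(2)[OF E(3)[OF f] cmod_FT_le] B(1) unfolding E(1,2)[OF f] by (simp add: ennreal_mult)
  qed (use B in auto)
  have lo: "ennreal (A / 2 * l2_norm_sq f) \<le> coef_energy f ?u" if "f \<in> L2" for f
  proof (rule frame_lower_extend[OF uL2 _ _ up _ that])
    fix f assume f: "tame f"
    show "ennreal (A * l2_norm_sq f) \<le> coef_energy f ?u"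
      using A(2)[OF E(3)[OF f] cmod_FT_le] A(1) unfolding E(1,2)[OF f] by (simp add: ennreal_mult)
  qed (use A B in auto)
  show ?thesis
    by (rule gabor_frameI[OF _ B(1) lo up]) (use A in auto)
qed

subsection \<open>Necessity\<close>

text \<open>Gaussian elimination, by induction on the equations: a nonzero pivot
  \<open>M e k0\<close> eliminates one unknown together with equation \<open>e\<close>.\<close>

lemma underdetermined_system:
  fixes M :: "'a \<Rightarrow> 'b \<Rightarrow> 'c::field"
  assumes "finite I" "finite K" "card I < card K"
  shows "\<exists>d. (\<exists>k\<in>K. d k \<noteq> 0) \<and> (\<forall>i\<in>I. (\<Sum>k\<in>K. M i k * d k) = 0)"
  using assms
proof (induction I arbitrary: K M rule: finite_induct)
  case empty
  then obtain k where "k \<in> K" by (metis card.empty less_irrefl all_not_in_conv)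
  then show ?case by (intro exI[of _ "\<lambda>_. 1"]) auto
next
  case (insert e I)
  show ?case
  proof (cases "\<forall>k\<in>K. M e k = 0")
    case True
    obtain d where "\<exists>k\<in>K. d k \<noteq> 0" "\<forall>i\<in>I. (\<Sum>k\<in>K. M i k * d k) = 0"
      using insert.IH[of K M] insert.prems insert.hyps by auto
    then show ?thesis using True by auto
  next
    case False
    then obtain k0 where k0: "k0 \<in> K" "M e k0 \<noteq> 0" by blast
    define K' where "K' = K - {k0}"
    have K': "finite K'" "card I < card K'" "K = insert k0 K'" "k0 \<notin> K'"
      using insert.prems insert.hyps k0 by (auto simp: K'_def card_Diff_singleton_if)
    obtain d where d: "\<exists>k\<in>K'. d k \<noteq> 0" "\<And>i. i \<in> I \<Longrightarrow> (\<Sum>k\<in>K'. (M i k - M i k0 * M e k / M e k0) * d k) = 0"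
      using insert.IH[OF K'(1,2), of "\<lambda>i k. M i k - M i k0 * M e k / M e k0"] by blast
    \<comment> \<open>The value at the pivot is chosen to satisfy equation \<open>e\<close>.\<close>
    define d' where "d' = d(k0 := - (\<Sum>k\<in>K'. M e k * d k) / M e k0)"
    have sum: "(\<Sum>k\<in>K. M i k * d' k) = M i k0 * d' k0 + (\<Sum>k\<in>K'. M i k * d k)" for i
    proof -
      have "(\<Sum>k\<in>K'. M i k * d' k) = (\<Sum>k\<in>K'. M i k * d k)"
        using K'(4) by (intro sum.cong) (auto simp: d'_def)
      then show ?thesis using K' by simp
    qed
    have "(\<Sum>k\<in>K. M i k * d' k) = 0" if "i \<in> insert e I" for i
    proof (cases "i = e")
      case True
      then show ?thesis using sum[of e] k0 by (simp add: d'_def)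
    next
      case False
      then have "(\<Sum>k\<in>K'. M i k * d k) - M i k0 / M e k0 * (\<Sum>k\<in>K'. M e k * d k) = 0"
        using d(2)[of i] that by (simp add: sum_subtractf left_diff_distrib sum_distrib_left mult.assoc)
      then show ?thesis using sum[of i] by (simp add: d'_def)
    qed
    moreover have "\<exists>k\<in>K. d' k \<noteq> 0" using d(1) K' by (auto simp: d'_def)
    ultimately show ?thesis by blast
  qed
qed

text \<open>The offending function is \<open>FT \<phi>\<close>: all its coefficients vanish by
  \<open>orth\<close> while its norm equals that of \<phi>, which contradicts the lower frame
  bound.\<close>

lemma not_gabor_frameI:
  assumes w: "w < 0" and \<phi>: "tame \<phi>" "l2_norm_sq \<phi> > 0"
    and orth: "\<And>m n. FT (\<lambda>\<xi>. \<phi> \<xi> * exp_window b w (\<xi> - \<beta> * of_int m)) (\<alpha> * of_int n) = 0"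
  shows "\<not> gabor_frame (\<lambda>t. pi * FT (exp_window b w) t) \<alpha> \<beta>"
proof
  assume "gabor_frame (\<lambda>t. pi * FT (exp_window b w) t) \<alpha> \<beta>"
  then obtain A where A: "A > 0" "\<And>f. f \<in> L2 \<Longrightarrow> A * l2_norm_sq f \<le>
      (\<Sum>\<^sub>\<infinity>(m::int, n::int)\<in>UNIV. (cmod (l2_inner f (tf_shift (\<alpha> * of_int n) (\<beta> * of_int m) (\<lambda>t. pi * FT (exp_window b w) t))))\<^sup>2)"
    unfolding gabor_frame_def by blast
  have "l2_inner (FT \<phi>) (tf_shift (\<alpha> * of_int n) (\<beta> * of_int m) (\<lambda>t. pi * FT (exp_window b w) t)) = 0" for m n :: int
    unfolding tf_shift_FT_window FT_l2_inner[OF \<phi>(1) tame_gabor_atom[OF w]] l2_inner_gabor_atom by (simp add: orth)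
  then have "A * l2_norm_sq (FT \<phi>) \<le> 0" using A(2)[OF FT_L2[OF \<phi>(1)]] by (simp add: case_prod_unfold)
  then show False using A(1) \<phi>(2) by (simp add: FT_l2_norm_sq[OF \<phi>(1)] mult_le_0_iff)
qed

text \<open>The test interval is the gap between the windows centred at 0 and \<beta>; windows with
  index at most 0 end before it and those with index at least 1 start after it.\<close>

lemma not_gabor_frame_gap:
  assumes b: "b > 0" and w: "w < 0" and \<beta>: "\<beta> > b"
  shows "\<not> gabor_frame (\<lambda>t. pi * FT (exp_window b w) t) \<alpha> \<beta>"
proof (rule not_gabor_frameI[OF w tame_indicator[of "b/2" "\<beta> - b/2"]])
  have "(cmod (indicator {b/2..<\<beta> - b/2} t))\<^sup>2 = indicat_real {b/2..<\<beta> - b/2} t" for t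
    by (simp add: indicator_def)
  then show "l2_norm_sq (indicator {b/2..<\<beta> - b/2}) > 0"
    using \<beta> b by (simp add: l2_norm_sq_def)
  fix m n :: int
  have "indicator {b/2..<\<beta> - b/2} \<xi> * exp_window b w (\<xi> - \<beta> * of_int m) = 0" for \<xi>
  proof (rule ccontr)
    assume "\<not> ?thesis"
    then have \<xi>: "b/2 \<le> \<xi>" "\<xi> < \<beta> - b/2" "-b/2 \<le> \<xi> - \<beta> * of_int m" "\<xi> - \<beta> * of_int m < b/2"
      by (auto simp: exp_window_nonzero_iff indicator_def split: if_splits)
    have "m \<le> 0 \<or> m \<ge> 1" by linarith
    then show False
    proof
      assume "m \<le> 0"
      then have "\<beta> * of_int m \<le> 0" using \<beta> b by (simp add: mult_nonneg_nonpos)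
      then show False using \<xi> by linarith
    next
      assume "m \<ge> 1"
      then have "\<beta> * 1 \<le> \<beta> * of_int m" using \<beta> b by (intro mult_left_mono) auto
      then show False using \<xi> by linarith
    qed
  qed
  then have "(\<lambda>\<xi>. indicator {b/2..<\<beta> - b/2} \<xi> * exp_window b w (\<xi> - \<beta> * of_int m)) = (\<lambda>\<xi>. 0)" by blast
  then show "FT (\<lambda>\<xi>. indicator {b/2..<\<beta> - b/2} \<xi> * exp_window b w (\<xi> - \<beta> * of_int m)) (\<alpha> * of_int n) = 0"
    by (simp only: FT_def) simp
qed

text \<open>An indicator of a half-open interval is right-continuous. This lets the linear system
  solved at x = 0 govern all small positive \<open>x\<close>.\<close>

lemma window_indicator_right_constant:
  fixes y :: real
  shows "eventually (\<lambda>x. (-b/2 \<le> x + y \<and> x + y < b/2) \<longleftrightarrow> (-b/2 \<le> y \<and> y < b/2)) (at_right 0)"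
proof -
  have "\<exists>e>0. \<forall>x>0. x < e \<longrightarrow> ((-b/2 \<le> x + y \<and> x + y < b/2) \<longleftrightarrow> (-b/2 \<le> y \<and> y < b/2))"
  proof (cases "y < -b/2")
    case True
    then show ?thesis by (intro exI[of _ "-b/2 - y"]) auto
  next
    case False
    show ?thesis
    proof (cases "y < b/2")
      case True
      then show ?thesis using False by (intro exI[of _ "b/2 - y"]) auto
    next
      case F: False
      then show ?thesis by (intro exI[of _ 1]) auto
    qed
  qed
  then show ?thesis unfolding eventually_at_right_field by auto
qed

lemma not_gabor_frame_density:
  assumes b: "b > 0" and w: "w < 0" and \<alpha>: "\<alpha> > 0" and \<beta>: "\<beta> > 0" and dens: "\<alpha> * \<beta> > 1"
  shows "\<not> gabor_frame (\<lambda>t. pi * FT (exp_window b w) t) \<alpha> \<beta>"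
proof -
  define p where "p = 1 / \<alpha>"
  have p: "p > 0" "p < \<beta>" using \<alpha> dens by (auto simp: p_def field_simps)
  \<comment> \<open>The number of relevant windows is at most N p/\<beta> + b/\<beta> + 2, and p <
    \<beta>, so a large \<open>N\<close> yields more unknowns than equations.\<close>
  obtain N :: nat where N: "b / \<beta> + 2 < real N * (1 - p / \<beta>)"
    using reals_Archimedean3[of "1 - p / \<beta>"] p \<beta> by auto
  define K where "K = {0..<int N}"
  \<comment> \<open>Contains every index whose window can meet one of the points x + k p with 0
    \<le> x < p and \<open>k\<close> in \<open>K\<close>; see \<open>inE\<close>.\<close>
  define E where "E = {m::int. -b/2 \<le> 0 + of_int m * \<beta> \<and> 0 + of_int m * \<beta> < -b/2 + (real N * p + b + \<beta>)}"
  have l0: "real N * p + b + \<beta> \<ge> 0" using p b \<beta> by simp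
  have E: "finite E" unfolding E_def by (rule card_int_progression(1)[OF \<beta> l0])
  have "real (card E) \<le> (real N * p + b + \<beta>) / \<beta> + 1"
    unfolding E_def by (rule card_int_progression(2)[OF \<beta> l0])
  also have "\<dots> = real N * (p / \<beta>) + b / \<beta> + 2" using \<beta> by (simp add: add_divide_distrib)
  also have "\<dots> < real N" using N by (simp add: right_diff_distrib)
  finally have card: "card E < card K" by (simp add: K_def)
  have inE: "m \<in> E" if "k \<in> K" "0 \<le> x" "x < p" "-b/2 \<le> x + (of_int k * p - \<beta> * of_int m)" "x + (of_int k * p - \<beta> * of_int m) < b/2" for k m x
  proof -
    have "0 \<le> of_int k * p" using that p by (simp add: K_def)
    moreover have "(of_int k + 1) * p \<le> real N * p" using that p by (intro mult_right_mono) (auto simp: K_def)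
    ultimately show ?thesis using that \<beta> unfolding E_def by (auto simp: algebra_simps)
  qed
  \<comment> \<open>The Gabor matrix at x = 0 without the factor
    \<open>exp (- 2 * pi * w * \<beta> * m)\<close>, which is constant along a row and does not
    affect the solutions.\<close>
  define M where "M m k = (if -b/2 \<le> of_int k * p - \<beta> * of_int m \<and> of_int k * p - \<beta> * of_int m < b/2
       then complex_of_real (exp (2 * pi * w * (of_int k * p))) else 0)" for m k :: int
  obtain d where d: "\<exists>k\<in>K. d k \<noteq> 0" "\<And>m. m \<in> E \<Longrightarrow> (\<Sum>k\<in>K. M m k * d k) = 0"
    using underdetermined_system[OF E _ card, of M] by (auto simp: K_def)
  have d0: "(\<Sum>k\<in>K. M m k * d k) = 0" for m
  proof (cases "m \<in> E")
    case False
    then have "M m k = 0" if "k \<in> K" for k using inE[OF that, of 0 m] p by (auto simp: M_def)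
    then show ?thesis by simp
  qed (rule d(2))
  have "eventually (\<lambda>x. \<forall>k\<in>K. \<forall>m\<in>E. (-b/2 \<le> x + (of_int k * p - \<beta> * of_int m) \<and> x + (of_int k * p - \<beta> * of_int m) < b/2) \<longleftrightarrow>
       (-b/2 \<le> of_int k * p - \<beta> * of_int m \<and> of_int k * p - \<beta> * of_int m < b/2)) (at_right 0)"
    using E by (intro eventually_ball_finite ballI window_indicator_right_constant) (auto simp: K_def)
  then obtain e where e: "e > 0" "\<And>x k m. 0 < x \<Longrightarrow> x < e \<Longrightarrow> k \<in> K \<Longrightarrow> m \<in> E \<Longrightarrow>
      (-b/2 \<le> x + (of_int k * p - \<beta> * of_int m) \<and> x + (of_int k * p - \<beta> * of_int m) < b/2) \<longleftrightarrow>
       (-b/2 \<le> of_int k * p - \<beta> * of_int m \<and> of_int k * p - \<beta> * of_int m < b/2)"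
    unfolding eventually_at_right_field by blast
  \<comment> \<open>Below \<open>e\<close> the pattern of windows seeing the chosen points does not
    change; below \<open>p\<close> the intervals supporting \<phi> are disjoint.\<close>
  define \<epsilon> where "\<epsilon> = min e p"
  have \<epsilon>: "\<epsilon> > 0" "\<epsilon> \<le> e" "\<epsilon> \<le> p" using e p by (auto simp: \<epsilon>_def)
  have win: "exp_window b w (x + of_int k * p - \<beta> * of_int m) = of_real (exp (2 * pi * w * (x - \<beta> * of_int m))) * M m k"
    if x: "0 \<le> x" "x < \<epsilon>" "k \<in> K" for x k m
  proof -
    have iff: "(-b/2 \<le> x + (of_int k * p - \<beta> * of_int m) \<and> x + (of_int k * p - \<beta> * of_int m) < b/2) \<longleftrightarrow>
       (-b/2 \<le> of_int k * p - \<beta> * of_int m \<and> of_int k * p - \<beta> * of_int m < b/2)"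
    proof (cases "m \<in> E")
      case True
      \<comment> \<open>The right-sided neighbourhood speaks only of x > 0; at x = 0 both sides
        coincide.\<close>
      then show ?thesis using e(2)[of x k m] x \<epsilon> by (cases "x = 0") auto
    next
      case False
      then show ?thesis using inE[OF x(3), of x m] inE[OF x(3), of 0 m] x \<epsilon> p by auto
    qed
    show ?thesis
    proof (cases "-b/2 \<le> of_int k * p - \<beta> * of_int m \<and> of_int k * p - \<beta> * of_int m < b/2")
      case True
      have "exp (2 * pi * w * (x + of_int k * p - \<beta> * of_int m)) = exp (2 * pi * w * (x - \<beta> * of_int m)) * exp (2 * pi * w * (of_int k * p))"
        by (simp add: algebra_simps flip: exp_add)
      then show ?thesis using iff True by (simp add: exp_window_def M_def add_diff_eq)
    next
      case False
      then have "exp_window b w (x + of_int k * p - \<beta> * of_int m) = 0"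
        using iff exp_window_nonzero_iff[of b w "x + of_int k * p - \<beta> * of_int m"] by (auto simp: add_diff_eq)
      then show ?thesis using False by (simp add: M_def)
    qed
  qed
  \<comment> \<open>On every fibre with x < \<epsilon> the sequence of values of \<phi> is the
    solution \<open>d\<close>, and on the other fibres it is zero.\<close>
  define \<phi> where "\<phi> \<xi> = (\<Sum>k\<in>K. d k * indicator {of_int k * p..<of_int k * p + \<epsilon>} \<xi>)" for \<xi>
  have \<phi>: "\<phi> (x + of_int k * p) = (if k \<in> K \<and> x < \<epsilon> then d k else 0)" if x: "x \<in> {0..<p}" for x k
  proof -
    have "indicator {of_int j * p..<of_int j * p + \<epsilon>} (x + of_int k * p) = (if j = k \<and> x < \<epsilon> then 1 else 0 :: complex)" for j
    proof (cases "j = k")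
      case False
      then have "of_int j + 1 \<le> (of_int k :: real) \<or> of_int k + 1 \<le> (of_int j :: real)" by linarith
      then have "(of_int j + 1) * p \<le> of_int k * p \<or> (of_int k + 1) * p \<le> of_int j * p"
        using p by (simp add: mult_le_cancel_right)
      then show ?thesis using False x \<epsilon> by (auto simp: indicator_def distrib_right)
    qed (use x in \<open>auto simp: indicator_def\<close>)
    then have "\<phi> (x + of_int k * p) = (\<Sum>j\<in>K. if j = k then (if x < \<epsilon> then d k else 0) else 0)"
      unfolding \<phi>_def by (intro sum.cong) auto
    then show ?thesis by (simp add: K_def)
  qed
  have tame: "tame \<phi>" unfolding \<phi>_def by (intro tame_sum tame_cmult tame_indicator) (simp add: K_def)
  show ?thesis
  proof (rule not_gabor_frameI[OF w tame])
    obtain k where k: "k \<in> K" "d k \<noteq> 0" using d(1) by blast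
    have "0 < (cmod (d k))\<^sup>2 * \<epsilon>" using k \<epsilon> by simp
    also have "\<dots> = (LINT \<xi>|lborel. (cmod (d k))\<^sup>2 * indicat_real {of_int k * p..<of_int k * p + \<epsilon>} \<xi>)"
      using \<epsilon> by simp
    also have "\<dots> \<le> l2_norm_sq \<phi>"
      unfolding l2_norm_sq_def
    proof (rule integral_mono)
      show "integrable lborel (\<lambda>\<xi>. (cmod (d k))\<^sup>2 * indicat_real {of_int k * p..<of_int k * p + \<epsilon>} \<xi>)"
        by (intro integrable_mult_right integrable_real_indicator) (use \<epsilon> in auto)
      show "integrable lborel (\<lambda>\<xi>. (cmod (\<phi> \<xi>))\<^sup>2)" by (rule tame_square_integrable[OF tame])
      fix \<xi>
      show "(cmod (d k))\<^sup>2 * indicat_real {of_int k * p..<of_int k * p + \<epsilon>} \<xi> \<le> (cmod (\<phi> \<xi>))\<^sup>2"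
        using \<phi>[of "\<xi> - of_int k * p" k] k \<epsilon> by (auto simp: indicator_def)
    qed
    finally show "l2_norm_sq \<phi> > 0" .
    fix m n :: int
    define h where "h \<xi> = \<phi> \<xi> * exp_window b w (\<xi> - \<beta> * of_int m)" for \<xi>
    have h: "tame h" unfolding h_def
      using tame_shift[OF tame_exp_window[OF w, of b], of "- (\<beta> * of_int m)"] by (intro tame_prod tame) simp
    \<comment> \<open>The periodization of \<phi> times a window is a row of the system applied to
      \<open>d\<close>, up to a common factor. It vanishes, so the transform is zero at all
      multiples of \<alpha> = 1/p.\<close>
    have "(\<Sum>\<^sub>\<infinity>k. h (x + of_int k * p)) = 0" if x: "x \<in> {0..<p}" for x
    proof (cases "x < \<epsilon>")
      case True
      have "(\<Sum>\<^sub>\<infinity>k. h (x + of_int k * p)) = (\<Sum>\<^sub>\<infinity>k\<in>K. of_real (exp (2 * pi * w * (x - \<beta> * of_int m))) * (M m k * d k))"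
        using x True by (intro infsum_cong_neutral) (auto simp: h_def \<phi> win)
      also have "\<dots> = of_real (exp (2 * pi * w * (x - \<beta> * of_int m))) * (\<Sum>k\<in>K. M m k * d k)"
        by (simp add: K_def sum_distrib_left)
      finally show ?thesis by (simp add: d0)
    qed (use x in \<open>simp add: h_def \<phi>\<close>)
    then have "(\<lambda>x. indicator {0..<p} x * (\<Sum>\<^sub>\<infinity>k. h (x + of_int k * p))) = (\<lambda>x. 0)"
      by (auto simp: indicator_def)
    then have "FT h (of_int n / p) = 0"
      unfolding tame_periodization(2)[OF h p(1), symmetric] by (simp add: FT_def)
    then show "FT (\<lambda>\<xi>. \<phi> \<xi> * exp_window b w (\<xi> - \<beta> * of_int m)) (\<alpha> * of_int n) = 0"
      by (simp add: h_def[abs_def] p_def mult.commute)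
  qed
qed

theorem theorem2:
  fixes b w :: real
  assumes "b > 0" and "w < 0"
  defines "g \<equiv> (\<lambda>t::real. sin (complex_of_real (pi * b) * (complex_of_real t - \<i> * complex_of_real w))
                          / (complex_of_real t - \<i> * complex_of_real w))"
  shows "frame_set g = {(\<alpha>, \<beta>). \<alpha> > 0 \<and> \<beta> > 0 \<and> \<alpha> * \<beta> \<le> 1 \<and> \<beta> \<le> b}"
proof -
  have g: "g = (\<lambda>t. pi * FT (exp_window b w) t)"
    unfolding g_def using FT_exp_window[OF assms(2,1)] by auto
  have "gabor_frame g \<alpha> \<beta> \<longleftrightarrow> \<alpha> * \<beta> \<le> 1 \<and> \<beta> \<le> b" if "\<alpha> > 0" "\<beta> > 0" for \<alpha> \<beta>
    using exp_window_gabor_frame[OF assms(1,2) that] not_gabor_frame_gap[OF assms(1,2), of \<beta> \<alpha>]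
      not_gabor_frame_density[OF assms(1,2) that] unfolding g by fastforce
  then show ?thesis unfolding frame_set_def by auto
qed

end
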